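(* Let $\mathcal F=(F,<,+,\cdot,0,1,\ldots)$ be a definably complete expansion of an ordered field which enjoys the definable choice property and admits a good $(0+)$-pseudo-filter $\mathfrak D$. Let $X$ and $Y$ be definable sets and $f:X\to Y$ a definable continuous map. The following are equivalent: (i) The map $f$ is definably identifying. (ii) For every pseudo-curve $\beta:E\to Y$ such that $\operatorname{Lim}(\beta)$ is a singleton and contained in $Y$, there exist a pseudo-curve $\alpha:D\to X$ and a point $x\in X$ such that $f\circ\alpha(D)\subseteq\beta(E)$, $\operatorname{Lim}(\alpha)=\{x\}$ and $f(x)\in\operatorname{Lim}(\beta)$. (iii) For every pseudo-curve $\beta:E\to Y$ such that $\operatorname{Lim}(\beta)$ is a singleton and contained in $Y$, there exist $D\in\mathfrak D$, a definable map $\alpha:D\to X$ and a point $x\in\operatorname{Lim}(\alpha)\cap X$ such that $f\circ\alpha(D)\subseteq\beta(E)$ and $f(x)\in\operatorname{Lim}(\beta)$.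
   Context: Let $\mathcal F=(F,<,\ldots)$ be an expansion of a dense linear order without endpoints. "Definable" means definable in $\mathcal F$ with parameters; a definable map is a map between definable sets whose graph is definable. $F$ carries the order topology, $F^n$ the product topology, and subsets of $F^n$ the relative topology. $\mathcal F$ is definably complete if every definable subset of $F$ has both a supremum and an infimum in $F\cup\{\pm\infty\}$. A definable continuous map $f:X\to Y$ is definably identifying if it is surjective and, for every definable subset $K$ of $Y$, $K$ is closed in $Y$ whenever $f^{-1}(K)$ is closed in $X$. Definable choice property: (1) for every coordinate projection $\pi:F^{m+n}\to F^m$ and definable sets $X\subseteq F^m$, $Y\subseteq F^{m+n}$ with $\pi(Y)=X$, there is a definable map $\varphi:X\to Y$ with $\pi(\varphi(x))=x$ for all $x\in X$; (2) for every definable equivalence relation $E$ on a definable set $X$ (i.e. $E\subseteq X\times X$ is definable and is an equivalence relation) there is a definable subset $S\subseteq X$ meeting each equivalence class of $E$ in exactly one point. Good $(0+)$-pseudo-filter: let $\mathfrak D$ be a nonempty family of definable subsets of $(0,\infty)$ whose closure in $F$ contains $0$. For a definable set $D\subseteq(0,\infty)$ with $0$ in its closure and a definable map $f:D\to F^n$, the limit set $\operatorname{Lim}(f)$ is the set of $p\in F^n$ such that $f^{-1}(B)\cap I\neq\emptyset$ for every open box $B\subseteq F^n$ containing $p$ and every open interval $I$ containing $0$ (for a map into a definable subset of $F^n$, the limit set is taken in the ambient space $F^n$). $\mathfrak D$ is a good $(0+)$-pseudo-filter if: (a) each $D\in\mathfrak D$ is bounded in $F$ and $\operatorname{cl}_F(D)=D\cup\{0\}$;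 (b) for each $D\in\mathfrak D$ and definable $D_1,D_2$ with $D=D_1\cup D_2$, either $D_1$ or $D_2$ contains an element of $\mathfrak D$; (c) for $D\in\mathfrak D$ and a definable map $\gamma:D\to F^n$, there is $D'\in\mathfrak D$ with $D'\subseteq D$ such that $\gamma|_{D'}$ is continuous; furthermore, if $\operatorname{Lim}(\gamma)\ne\emptyset$, $D'$ can be taken so that $\operatorname{Lim}(\gamma|_{D'})$ is a singleton. A pseudo-curve is a definable continuous map $D\to F^n$ with $D\in\mathfrak D$; a pseudo-curve $\gamma:D\to X$ is one with image in $X$. *)

theory Defs
  imports "HOL-Analysis.Analysis" "HOL-Library.Extended" "HOL-Library.Lub_Glb"
begin

section \<open>First-order expansions of an ordered field\<close>

text \<open>
  The ordered field is the type \<open>'a\<close>; its order and ring operations are built into the syntax.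
  The additional structure is given by function symbols \<open>'f\<close> and relation symbols \<open>'r\<close>. A symbol
  together with the length of its argument list is treated as a symbol of that arity, so that every
  first-order expansion arises (interpret unused arities trivially) and constants are symbols
  applied to \<open>[]\<close>.
\<close>

datatype 'f tm =
    Var nat
  | Zero
  | One
  | Add "'f tm" "'f tm"
  | Mul "'f tm" "'f tm"
  | Fun 'f "'f tm list"

datatype ('f, 'r) fm =
    Eq "'f tm" "'f tm"
  | Less "'f tm" "'f tm"
  | Rel 'r "'f tm list"
  | Neg "('f, 'r) fm"
  | Conj "('f, 'r) fm" "('f, 'r) fm"
  | Ex nat "('f, 'r) fm"

record ('f, 'r, 'a) expansion =
  fun_int :: "'f \<Rightarrow> 'a list \<Rightarrow> 'a"
  rel_int :: "'r \<Rightarrow> 'a list \<Rightarrow> bool"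

primrec tm_val :: "('f, 'r, 'a::linordered_field) expansion \<Rightarrow> (nat \<Rightarrow> 'a) \<Rightarrow> 'f tm \<Rightarrow> 'a" where
  "tm_val M e (Var i) = e i"
| "tm_val M e Zero = 0"
| "tm_val M e One = 1"
| "tm_val M e (Add s t) = tm_val M e s + tm_val M e t"
| "tm_val M e (Mul s t) = tm_val M e s * tm_val M e t"
| "tm_val M e (Fun g ts) = fun_int M g (map (tm_val M e) ts)"

primrec sat :: "('f, 'r, 'a::linordered_field) expansion \<Rightarrow> (nat \<Rightarrow> 'a) \<Rightarrow> ('f, 'r) fm \<Rightarrow> bool" where
  "sat M e (Eq s t) \<longleftrightarrow> tm_val M e s = tm_val M e t"
| "sat M e (Less s t) \<longleftrightarrow> tm_val M e s < tm_val M e t"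
| "sat M e (Rel r ts) \<longleftrightarrow> rel_int M r (map (tm_val M e) ts)"
| "sat M e (Neg p) \<longleftrightarrow> \<not> sat M e p"
| "sat M e (Conj p q) \<longleftrightarrow> sat M e p \<and> sat M e q"
| "sat M e (Ex i p) \<longleftrightarrow> (\<exists>a. sat M (e(i := a)) p)"


section \<open>Cartesian powers and definability\<close>

text \<open>
  A point of \<open>F\<^sup>n\<close> is a function on \<open>{..<n}\<close> extended by \<open>undefined\<close>, so that \<open>F\<^sup>n\<close> is the
  underlying set of the library's product topology.
\<close>

definition cpow :: "nat \<Rightarrow> (nat \<Rightarrow> 'a) set" where
  "cpow n = (\<Pi>\<^sub>E i\<in>{..<n}. UNIV)"

definition cpow_top :: "nat \<Rightarrow> (nat \<Rightarrow> 'a::linorder_topology) topology" where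
  "cpow_top n = product_topology (\<lambda>i. euclidean) {..<n}"

definition point1 :: "'a \<Rightarrow> nat \<Rightarrow> 'a" where
  "point1 a = (\<lambda>i\<in>{..<1}. a)"

definition append_point :: "nat \<Rightarrow> nat \<Rightarrow> (nat \<Rightarrow> 'a) \<Rightarrow> (nat \<Rightarrow> 'a) \<Rightarrow> nat \<Rightarrow> 'a" where
  "append_point m n x y = (\<lambda>i\<in>{..<m + n}. if i < m then x i else y (i - m))"

text \<open>Variables below \<open>n\<close> are the coordinates; the remaining ones take parameter values from \<open>e\<close>.\<close>

definition definable ::
    "('f, 'r, 'a::linordered_field) expansion \<Rightarrow> nat \<Rightarrow> (nat \<Rightarrow> 'a) set \<Rightarrow> bool" where
  "definable M n X \<longleftrightarrow>
     (\<exists>p e. X = {x \<in> cpow n. sat M (\<lambda>i. if i < n then x i else e i) p})"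

definition definable1 :: "('f, 'r, 'a::linordered_field) expansion \<Rightarrow> 'a set \<Rightarrow> bool" where
  "definable1 M D \<longleftrightarrow> definable M 1 (point1 ` D)"

definition definable_rel ::
    "('f, 'r, 'a::linordered_field) expansion \<Rightarrow> nat \<Rightarrow> ((nat \<Rightarrow> 'a) \<times> (nat \<Rightarrow> 'a)) set \<Rightarrow> bool" where
  "definable_rel M n E \<longleftrightarrow> definable M (n + n) ((\<lambda>(x, y). append_point n n x y) ` E)"

text \<open>Maps are total functions of the logic of which only the values on \<open>X\<close> matter.\<close>

definition definable_map ::
    "('f, 'r, 'a::linordered_field) expansion \<Rightarrow> nat \<Rightarrow> nat \<Rightarrow> (nat \<Rightarrow> 'a) set \<Rightarrow> (nat \<Rightarrow> 'a) set
      \<Rightarrow> ((nat \<Rightarrow> 'a) \<Rightarrow> nat \<Rightarrow> 'a) \<Rightarrow> bool" where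
  "definable_map M m n X Y f \<longleftrightarrow>
     definable M m X \<and> definable M n Y \<and> f \<in> X \<rightarrow> Y \<and>
     definable M (m + n) ((\<lambda>x. append_point m n x (f x)) ` X)"

text \<open>Definable maps \<open>D \<rightarrow> Y\<close> with \<open>D \<subseteq> F\<close> and \<open>Y \<subseteq> F\<^sup>n\<close>.\<close>

definition definable_map1 ::
    "('f, 'r, 'a::linordered_field) expansion \<Rightarrow> nat \<Rightarrow> 'a set \<Rightarrow> (nat \<Rightarrow> 'a) set
      \<Rightarrow> ('a \<Rightarrow> nat \<Rightarrow> 'a) \<Rightarrow> bool" where
  "definable_map1 M n D Y g \<longleftrightarrow> definable_map M 1 n (point1 ` D) Y (\<lambda>x. g (x 0))"

definition definably_complete :: "('f, 'r, 'a::linordered_field) expansion \<Rightarrow> bool" where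
  "definably_complete M \<longleftrightarrow>
     (\<forall>A. definable1 M A \<longrightarrow>
        (\<exists>s. isLub UNIV (Fin ` A) s) \<and> (\<exists>t. isGlb UNIV (Fin ` A) t))"

definition definably_identifying ::
    "('f, 'r, 'a::{linordered_field, linorder_topology}) expansion \<Rightarrow> nat \<Rightarrow> nat
      \<Rightarrow> (nat \<Rightarrow> 'a) set \<Rightarrow> (nat \<Rightarrow> 'a) set \<Rightarrow> ((nat \<Rightarrow> 'a) \<Rightarrow> nat \<Rightarrow> 'a) \<Rightarrow> bool" where
  "definably_identifying M m n X Y f \<longleftrightarrow>
     definable_map M m n X Y f \<and>
     continuous_map (subtopology (cpow_top m) X) (subtopology (cpow_top n) Y) f \<and>
     f ` X = Y \<and>
     (\<forall>K. K \<subseteq> Y \<and> definable M n K \<and> closedin (subtopology (cpow_top m) X) {x \<in> X. f x \<in> K}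
        \<longrightarrow> closedin (subtopology (cpow_top n) Y) K)"


section \<open>Definable choice\<close>

text \<open>The coordinate projection \<open>F\<^sup>k \<rightarrow> F\<^sup>m\<close> selecting the coordinates \<open>s 0 < \<dots> < s (m - 1)\<close>.\<close>

definition coord_proj :: "nat \<Rightarrow> (nat \<Rightarrow> nat) \<Rightarrow> (nat \<Rightarrow> 'a) \<Rightarrow> nat \<Rightarrow> 'a" where
  "coord_proj m s y = (\<lambda>i\<in>{..<m}. y (s i))"

definition definable_choice :: "('f, 'r, 'a::linordered_field) expansion \<Rightarrow> bool" where
  "definable_choice M \<longleftrightarrow>
     (\<forall>m n s X Y. strict_mono_on {..<m} s \<and> s ` {..<m} \<subseteq> {..<m + n} \<and>
        definable M m X \<and> definable M (m + n) Y \<and> coord_proj m s ` Y = X \<longrightarrow>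
        (\<exists>h. definable_map M m (m + n) X Y h \<and> (\<forall>x\<in>X. coord_proj m s (h x) = x))) \<and>
     (\<forall>n X E. definable M n X \<and> equiv X E \<and> definable_rel M n E \<longrightarrow>
        (\<exists>S. S \<subseteq> X \<and> definable M n S \<and> (\<forall>C \<in> X // E. \<exists>!x. x \<in> S \<inter> C)))"


section \<open>Pseudo-curves\<close>

definition open_interval :: "'a::linorder set \<Rightarrow> bool" where
  "open_interval I \<longleftrightarrow> (\<exists>a b. I = {x. a < Fin x \<and> Fin x < b})"

definition open_box :: "nat \<Rightarrow> (nat \<Rightarrow> 'a::linorder) set \<Rightarrow> bool" where
  "open_box n B \<longleftrightarrow> (\<exists>J. (\<forall>i<n. open_interval (J i)) \<and> B = (\<Pi>\<^sub>E i\<in>{..<n}. J i))"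

definition Lim_set :: "nat \<Rightarrow> 'a::linordered_field set \<Rightarrow> ('a \<Rightarrow> nat \<Rightarrow> 'a) \<Rightarrow> (nat \<Rightarrow> 'a) set" where
  "Lim_set n D g =
     {p \<in> cpow n. \<forall>B I. open_box n B \<and> p \<in> B \<and> open_interval I \<and> 0 \<in> I
        \<longrightarrow> {t \<in> D. g t \<in> B} \<inter> I \<noteq> {}}"

definition good_pseudo_filter ::
    "('f, 'r, 'a::{linordered_field, linorder_topology}) expansion \<Rightarrow> 'a set set \<Rightarrow> bool" where
  "good_pseudo_filter M \<DD> \<longleftrightarrow>
     \<DD> \<noteq> {} \<and>
     (\<forall>D\<in>\<DD>. definable1 M D \<and> D \<subseteq> {0<..} \<and> 0 \<in> closure D) \<and>
     (\<forall>D\<in>\<DD>. bdd_below D \<and> bdd_above D \<and> closure D = D \<union> {0}) \<and>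
     (\<forall>D\<in>\<DD>. \<forall>D1 D2. definable1 M D1 \<and> definable1 M D2 \<and> D = D1 \<union> D2 \<longrightarrow>
        (\<exists>D'\<in>\<DD>. D' \<subseteq> D1) \<or> (\<exists>D'\<in>\<DD>. D' \<subseteq> D2)) \<and>
     (\<forall>D\<in>\<DD>. \<forall>n g. definable_map1 M n D (cpow n) g \<longrightarrow>
        (\<exists>D'\<in>\<DD>. D' \<subseteq> D \<and> continuous_map (top_of_set D') (cpow_top n) g) \<and>
        (Lim_set n D g \<noteq> {} \<longrightarrow>
          (\<exists>D'\<in>\<DD>. D' \<subseteq> D \<and> continuous_map (top_of_set D') (cpow_top n) g \<and>
             is_singleton (Lim_set n D' g))))"

definition pseudo_curve ::
    "('f, 'r, 'a::{linordered_field, linorder_topology}) expansion \<Rightarrow> 'a set set \<Rightarrow> nat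
      \<Rightarrow> 'a set \<Rightarrow> (nat \<Rightarrow> 'a) set \<Rightarrow> ('a \<Rightarrow> nat \<Rightarrow> 'a) \<Rightarrow> bool" where
  "pseudo_curve M \<DD> n D X g \<longleftrightarrow>
     D \<in> \<DD> \<and> definable_map1 M n D (cpow n) g \<and>
     continuous_map (top_of_set D) (cpow_top n) g \<and> g ` D \<subseteq> X"

end

theory Submission
  imports Defs
begin

text \<open>
  Definable choice, applied to the sets of points of \<open>Z\<close> at distance less than \<open>t\<close> from \<open>p\<close>, gives a
  curve selection principle: a point \<open>p\<close> in the closure of a definable set \<open>Z\<close> is the limit of a
  pseudo-curve in \<open>Z\<close>. Definable completeness shows that the closure of the image of a pseudo-curve
  \<open>\<beta>\<close> adds only limit points of \<open>\<beta>\<close>. If \<open>f\<close> is definably identifying and \<open>\<beta>\<close> converges to a point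
  \<open>y\<close> outside its image \<open>K\<close>, then \<open>K\<close> is not closed in \<open>Y\<close>, so some \<open>x \<in> X\<close> outside the preimage of
  \<open>K\<close> is the limit of a pseudo-curve in that preimage; \<open>f x\<close> lies in the closure of \<open>K\<close> but not in
  \<open>K\<close>, hence equals \<open>y\<close>. Conversely, lifting constant curves gives surjectivity, and a definable
  \<open>K\<close> with closed preimage is closed because a curve in \<open>K\<close> tending to \<open>y \<in> Y\<close> lifts into the
  preimage.
\<close>

section \<open>Predicates definable with parameters\<close>

primrec tm_vars :: "'f tm \<Rightarrow> nat set" where
  "tm_vars (Var i) = {i}"
| "tm_vars Zero = {}"
| "tm_vars One = {}"
| "tm_vars (Add s t) = tm_vars s \<union> tm_vars t"
| "tm_vars (Mul s t) = tm_vars s \<union> tm_vars t"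
| "tm_vars (Fun g ts) = \<Union> (set (map tm_vars ts))"

text \<open>Bound variables are kept, so this set may exceed the free variables. It stays finite,
  and an index outside it is fresh for bound occurrences as well.\<close>

primrec fm_vars :: "('f, 'r) fm \<Rightarrow> nat set" where
  "fm_vars (Eq s t) = tm_vars s \<union> tm_vars t"
| "fm_vars (Less s t) = tm_vars s \<union> tm_vars t"
| "fm_vars (Rel r ts) = \<Union> (tm_vars ` set ts)"
| "fm_vars (Neg p) = fm_vars p"
| "fm_vars (Conj p q) = fm_vars p \<union> fm_vars q"
| "fm_vars (Ex i p) = fm_vars p"

lemma finite_tm_vars: "finite (tm_vars t)"
  by (induction t) auto

lemma finite_fm_vars: "finite (fm_vars p)"
  by (induction p) (auto simp: finite_tm_vars)

lemma tm_val_cong: "(\<And>i. i \<in> tm_vars t \<Longrightarrow> e i = e' i) \<Longrightarrow> tm_val M e t = tm_val M e' t"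
proof (induction t)
  case (Fun g ts)
  have "map (tm_val M e) ts = map (tm_val M e') ts"
    by (rule map_cong[OF refl], rule Fun.IH) (use Fun.prems in auto)
  then show ?case by (simp only: tm_val.simps)
qed auto

lemma sat_cong: "(\<And>i. i \<in> fm_vars p \<Longrightarrow> e i = e' i) \<Longrightarrow> sat M e p = sat M e' p"
proof (induction p arbitrary: e e')
  case (Eq s t)
  then show ?case using tm_val_cong[of s e e' M] tm_val_cong[of t e e' M] by simp
next
  case (Less s t)
  then show ?case using tm_val_cong[of s e e' M] tm_val_cong[of t e e' M] by simp
next
  case (Rel r ts)
  have "map (tm_val M e) ts = map (tm_val M e') ts"
    by (rule map_cong[OF refl], rule tm_val_cong) (use Rel.prems in auto)
  then show ?case by (simp only: sat.simps)
next
  case (Neg p)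
  have "sat M e p = sat M e' p" by (rule Neg.IH) (use Neg.prems in auto)
  then show ?case by (simp only: sat.simps)
next
  case (Conj p q)
  have "sat M e p = sat M e' p" "sat M e q = sat M e' q"
    by (rule Conj.IH; use Conj.prems in auto)+
  then show ?case by (simp only: sat.simps)
next
  case (Ex i p)
  have "sat M (e(i := a)) p = sat M (e'(i := a)) p" for a
    by (rule Ex.IH) (use Ex.prems in auto)
  then show ?case by (simp only: sat.simps)
qed

primrec tm_rename :: "(nat \<Rightarrow> nat) \<Rightarrow> 'f tm \<Rightarrow> 'f tm" where
  "tm_rename \<rho> (Var i) = Var (\<rho> i)"
| "tm_rename \<rho> Zero = Zero"
| "tm_rename \<rho> One = One"
| "tm_rename \<rho> (Add s t) = Add (tm_rename \<rho> s) (tm_rename \<rho> t)"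
| "tm_rename \<rho> (Mul s t) = Mul (tm_rename \<rho> s) (tm_rename \<rho> t)"
| "tm_rename \<rho> (Fun g ts) = Fun g (map (tm_rename \<rho>) ts)"

lemma tm_val_rename: "tm_val M e (tm_rename \<rho> t) = tm_val M (\<lambda>i. e (\<rho> i)) t"
proof (induction t)
  case (Fun g ts)
  have "map (tm_val M e \<circ> tm_rename \<rho>) ts = map (tm_val M (\<lambda>i. e (\<rho> i))) ts"
    by (rule map_cong[OF refl]) (simp add: Fun.IH)
  then show ?case by (simp only: tm_rename.simps tm_val.simps list.map_comp)
qed auto

text \<open>Renaming is a syntactic operation on formulas, up to the choice of bound variables:
  \<open>q\<close> depends on \<open>\<rho>\<close> and \<open>p\<close> but not on
  \<open>e\<close>. The map \<open>\<rho>\<close> may identify variables, so a binder has to be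
  moved out of its range first.\<close>

lemma sat_rename: "\<exists>q. \<forall>e. sat M e q = sat M (\<lambda>i. e (\<rho> i)) p"
proof (induction p arbitrary: \<rho>)
  case (Eq s t)
  show ?case by (rule exI[of _ "Eq (tm_rename \<rho> s) (tm_rename \<rho> t)"]) (simp add: tm_val_rename)
next
  case (Less s t)
  show ?case by (rule exI[of _ "Less (tm_rename \<rho> s) (tm_rename \<rho> t)"]) (simp add: tm_val_rename)
next
  case (Rel r ts)
  show ?case
    by (rule exI[of _ "Rel r (map (tm_rename \<rho>) ts)"]) (simp add: tm_val_rename comp_def)
next
  case (Neg p)
  then show ?case by (metis sat.simps(4))
next
  case (Conj p q)
  then show ?case by (metis sat.simps(5))
next
  case (Ex i p)
  \<comment> \<open>The quantified variable becomes \<open>j\<close>, which differs from every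
    renamed variable of \<open>p\<close>, so nothing is captured; the induction hypothesis is
    applied to \<open>\<rho>\<close> changed to send \<open>i\<close> to \<open>j\<close>.\<close>
  obtain j where j: "j \<notin> \<rho> ` fm_vars p"
    using ex_new_if_finite[OF infinite_UNIV_nat finite_imageI[OF finite_fm_vars]] by blast
  obtain q where q: "\<And>e. sat M e q = sat M (\<lambda>k. e ((\<rho>(i := j)) k)) p"
    using Ex.IH[of "\<rho>(i := j)"] by blast
  have "sat M (e(j := a)) q = sat M ((\<lambda>k. e (\<rho> k))(i := a)) p" for e a
    unfolding q by (rule sat_cong) (use j in auto)
  then show ?case by (intro exI[of _ "Ex j q"]) simp
qed

text \<open>Slots are what an object variable of a formula may be assigned to: a coordinate of the
  environment, or a parameter.\<close>

definition slot :: "((nat \<Rightarrow> 'a) \<Rightarrow> 'a) \<Rightarrow> bool" where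
  "slot v \<longleftrightarrow> (\<exists>j. v = (\<lambda>x. x j)) \<or> (\<exists>c. v = (\<lambda>_. c))"

text \<open>Definability with parameters for predicates on infinite environments. No arity is fixed,
  so connectives and quantifiers combine without reindexing; \<open>dpred_mem\<close> and
  \<open>definable_Collect\<close> translate from and to definable sets.\<close>

definition dpred :: "('f, 'r, 'a::linordered_field) expansion \<Rightarrow> ((nat \<Rightarrow> 'a) \<Rightarrow> bool) \<Rightarrow> bool" where
  "dpred M P \<longleftrightarrow> (\<exists>p s. (\<forall>i. slot (s i)) \<and> P = (\<lambda>x. sat M (\<lambda>i. s i x) p))"

section \<open>Closure of definable predicates under substitution, connectives and
  quantifiers\<close>

lemma slot_var: "slot (\<lambda>x. x j)" and slot_const: "slot (\<lambda>_. c)"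
  by (auto simp: slot_def)

lemma slot_subst: "slot v \<Longrightarrow> (\<And>i. slot (s i)) \<Longrightarrow> slot (\<lambda>x. v (\<lambda>i. s i x))"
  unfolding slot_def by (metis (no_types, lifting))

lemma dpred_sat: "(\<And>i. slot (s i)) \<Longrightarrow> dpred M (\<lambda>x. sat M (\<lambda>i. s i x) p)"
  unfolding dpred_def by blast

lemma dpred_subst:
  assumes "dpred M P" and s: "\<And>i. slot (s i)"
  shows "dpred M (\<lambda>x. P (\<lambda>i. s i x))"
proof -
  obtain p s' where s': "\<And>i. slot (s' i)" and P: "P = (\<lambda>x. sat M (\<lambda>i. s' i x) p)"
    using assms(1) unfolding dpred_def by blast
  show ?thesis unfolding P by (rule dpred_sat) (rule slot_subst[OF s' s])
qed

lemma dpred_not: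
  assumes "dpred M P" shows "dpred M (\<lambda>x. \<not> P x)"
proof -
  obtain p s where s: "\<And>i. slot (s i)" and P: "P = (\<lambda>x. sat M (\<lambda>i. s i x) p)"
    using assms unfolding dpred_def by blast
  show ?thesis unfolding P using dpred_sat[where s = s and M = M and p = "Neg p", OF s] by simp
qed

lemma dpred_conj:
  assumes "dpred M P" "dpred M Q" shows "dpred M (\<lambda>x. P x \<and> Q x)"
proof -
  obtain p s where s: "\<And>i. slot (s i)" and P: "P = (\<lambda>x. sat M (\<lambda>i. s i x) p)"
    using assms(1) unfolding dpred_def by blast
  obtain q s' where s': "\<And>i. slot (s' i)" and Q: "Q = (\<lambda>x. sat M (\<lambda>i. s' i x) q)"
    using assms(2) unfolding dpred_def by blast
  \<comment> \<open>The two formulas come with unrelated slot assignments. Moving the first to even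
    and the second to odd variables lets the single assignment \<open>u\<close> serve both.\<close>
  obtain p' where p': "\<And>e. sat M e p' = sat M (\<lambda>i. e (2 * i)) p"
    using sat_rename[of M "\<lambda>i. 2 * i" p] by blast
  obtain q' where q': "\<And>e. sat M e q' = sat M (\<lambda>i. e (Suc (2 * i))) q"
    using sat_rename[of M "\<lambda>i. Suc (2 * i)" q] by blast
  define u where "u i = (if even i then s (i div 2) else s' (i div 2))" for i :: nat
  have "dpred M (\<lambda>x. sat M (\<lambda>i. u i x) (Conj p' q'))"
    by (rule dpred_sat) (simp add: u_def s s')
  then show ?thesis by (simp add: P Q p' q' u_def)
qed

lemma dpred_imp: "dpred M P \<Longrightarrow> dpred M Q \<Longrightarrow> dpred M (\<lambda>x. P x \<longrightarrow> Q x)"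
  using dpred_not[OF dpred_conj[OF _ dpred_not], of M P Q] by simp

text \<open>Quantifiers follow the de Bruijn convention: the premise reads the bound variable from
  coordinate \<open>0\<close> and the environment from the shifted coordinates.\<close>

lemma dpred_ex:
  fixes M :: "('f, 'r, 'a::linordered_field) expansion"
  assumes "dpred M (\<lambda>x. Q (\<lambda>i. x (Suc i)) (x 0))"
  shows "dpred M (\<lambda>x. \<exists>a. Q x a)"
proof -
  obtain p s where s: "\<And>i. slot (s i)"
    and P: "\<And>x. Q (\<lambda>i. x (Suc i)) (x 0) = sat M (\<lambda>i. s i x) p"
    using assms unfolding dpred_def by metis
  \<comment> \<open>\<open>N\<close> will be the quantified variable: \<open>\<rho>\<close> sends to
    it every variable of \<open>p\<close> whose slot is coordinate \<open>0\<close>, and leaves the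
    others alone.\<close>
  obtain N where N: "N \<notin> fm_vars p"
    using ex_new_if_finite[OF infinite_UNIV_nat finite_fm_vars] by blast
  define \<rho> where "\<rho> i = (if s i = (\<lambda>x. x 0) then N else i)" for i
  \<comment> \<open>Composing with \<open>case_nat undefined\<close> undoes the shift of the
    environment: the slot of coordinate \<open>Suc j\<close> becomes that of \<open>j\<close>. The
    filler \<open>undefined\<close> sits at coordinate \<open>0\<close>, which the slots treated by
    this branch do not read.\<close>
  define s' where "s' i = (if s i = (\<lambda>x. x 0) then (\<lambda>x. x 0) else (\<lambda>x. s i (case_nat undefined x)))" for i
  have slot': "slot (s' i)" for i
  proof -
    consider j where "s i = (\<lambda>x. x (Suc j))" | "s i = (\<lambda>x. x 0)" | c where "s i = (\<lambda>x. c)"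
      using s[of i] unfolding slot_def by (metis not0_implies_Suc)
    then show ?thesis by cases (auto simp: s'_def slot_var slot_const)
  qed
  obtain q where q: "\<And>e. sat M e q = sat M (\<lambda>i. e (\<rho> i)) p"
    using sat_rename[of M \<rho> p] by blast
  have "sat M ((\<lambda>i. s' i x)(N := a)) q = Q x a" for x a
  proof -
    have "Q x a = sat M (\<lambda>i. s i (case_nat a x)) p"
      using P[of "case_nat a x"] by simp
    also have "\<dots> = sat M (\<lambda>i. ((\<lambda>i. s' i x)(N := a)) (\<rho> i)) p"
    proof (rule sat_cong)
      fix i assume i: "i \<in> fm_vars p"
      consider j where "s i = (\<lambda>x. x (Suc j))" | "s i = (\<lambda>x. x 0)" | c where "s i = (\<lambda>x. c)"
        using s[of i] unfolding slot_def by (metis not0_implies_Suc)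
      then show "s i (case_nat a x) = ((\<lambda>i. s' i x)(N := a)) (\<rho> i)"
      proof cases
        case 1
        \<comment> \<open>Since \<open>\<rho>\<close> and \<open>s'\<close> compare slots as
          functions, different kinds of slots must be shown to be different functions; an
          environment with two distinct values separates them.\<close>
        moreover have "(\<lambda>x::nat \<Rightarrow> 'a. x (Suc j)) \<noteq> (\<lambda>x. x 0)"
        proof
          assume eq: "(\<lambda>x::nat \<Rightarrow> 'a. x (Suc j)) = (\<lambda>x. x 0)"
          show False using fun_cong[OF eq, of "case_nat 0 (\<lambda>_. 1)"] by simp
        qed
        ultimately show ?thesis using N i by (auto simp: \<rho>_def s'_def)
      next
        case 2
        then show ?thesis by (simp add: \<rho>_def)
      next
        case 3
        moreover have "(\<lambda>x::nat \<Rightarrow> 'a. c) \<noteq> (\<lambda>x. x 0)"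
          by (auto simp: fun_eq_iff intro!: exI[of _ "\<lambda>_. c + 1"])
        ultimately show ?thesis using N i by (auto simp: \<rho>_def s'_def)
      qed
    qed
    finally show ?thesis by (simp add: q)
  qed
  then have "(\<lambda>x. \<exists>a. Q x a) = (\<lambda>x. sat M (\<lambda>i. s' i x) (Ex N q))"
    by (simp only: sat.simps)
  then show ?thesis by (simp only: dpred_sat[OF slot'])
qed

lemma dpred_all:
  assumes "dpred M (\<lambda>x. Q (\<lambda>i. x (Suc i)) (x 0))"
  shows "dpred M (\<lambda>x. \<forall>a. Q x a)"
  using dpred_not[OF dpred_ex[of M "\<lambda>x a. \<not> Q x a"]] dpred_not[OF assms] by simp

lemma dpred_eq:
  assumes "slot u" "slot v" shows "dpred M (\<lambda>x. u x = v x)"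
  using dpred_sat[of "case_nat u (\<lambda>_. v)" M "Eq (Var 0) (Var 1)"] assms by (simp split: nat.split)

lemma dpred_less:
  assumes "slot u" "slot v" shows "dpred M (\<lambda>x. u x < v x)"
  using dpred_sat[of "case_nat u (\<lambda>_. v)" M "Less (Var 0) (Var 1)"] assms by (simp split: nat.split)

lemma dpred_less_add:
  assumes "slot u" "slot v" "slot w" shows "dpred M (\<lambda>x. u x < v x + w x)"
  using dpred_sat[of "case_nat u (case_nat v (\<lambda>_. w))" M "Less (Var 0) (Add (Var 1) (Var 2))"] assms
  by (simp split: nat.split add: numeral_2_eq_2)

lemma dpred_True: "dpred M (\<lambda>x. True)"
  using dpred_eq[OF slot_const[of 0] slot_const[of 0]] by simp

lemma dpred_all_less:
  "(\<And>i. i < n \<Longrightarrow> dpred M (P i)) \<Longrightarrow> dpred M (\<lambda>x. \<forall>i<n. P i x)" for n :: nat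
proof (induction n)
  case 0
  show ?case by (simp add: dpred_True)
next
  case (Suc n)
  have "dpred M (\<lambda>x. (\<forall>i<n. P i x) \<and> P n x)"
    by (intro dpred_conj Suc.IH Suc.prems) auto
  moreover have "(\<lambda>x. \<forall>i<Suc n. P i x) = (\<lambda>x. (\<forall>i<n. P i x) \<and> P n x)"
    by (auto simp: less_Suc_eq)
  ultimately show ?case by simp
qed

section \<open>Passage between definable predicates and definable sets; quantification over
  tuples\<close>

lemma restrict_in_cpow: "(\<lambda>i\<in>{..<n}. z i) \<in> cpow n"
  by (simp add: cpow_def)

lemma restrict_cpow: "x \<in> cpow n \<Longrightarrow> (\<lambda>i\<in>{..<n}. x i) = x"
  by (simp add: cpow_def PiE_restrict)

lemma cpow_eqI: "x \<in> cpow n \<Longrightarrow> y \<in> cpow n \<Longrightarrow> (\<And>i. i < n \<Longrightarrow> x i = y i) \<Longrightarrow> x = y"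
  unfolding cpow_def by (rule PiE_ext) auto

lemma definable_subset_cpow: "definable M n X \<Longrightarrow> X \<subseteq> cpow n"
  unfolding definable_def by auto

text \<open>The coordinates may be filled by arbitrary slots, so a definable set can be used inside
  a larger formula at shifted or repeated coordinates, or at parameters.\<close>

lemma dpred_mem:
  assumes "definable M n X" and "\<And>i. slot (s i)"
  shows "dpred M (\<lambda>x. (\<lambda>i\<in>{..<n}. s i x) \<in> X)"
proof -
  obtain p e where X: "X = {x \<in> cpow n. sat M (\<lambda>i. if i < n then x i else e i) p}"
    using assms(1) unfolding definable_def by blast
  have "dpred M (\<lambda>x. sat M (\<lambda>i. (if i < n then s i else (\<lambda>_. e i)) x) p)"
    by (rule dpred_sat) (simp add: assms slot_const)
  also have "(\<lambda>x. sat M (\<lambda>i. (if i < n then s i else (\<lambda>_. e i)) x) p) =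
      (\<lambda>x. (\<lambda>i\<in>{..<n}. s i x) \<in> X)"
  proof
    fix x
    have "sat M (\<lambda>i. (if i < n then s i else (\<lambda>_. e i)) x) p \<longleftrightarrow>
        sat M (\<lambda>i. if i < n then (\<lambda>i\<in>{..<n}. s i x) i else e i) p"
      by (rule sat_cong) simp
    then show "sat M (\<lambda>i. (if i < n then s i else (\<lambda>_. e i)) x) p \<longleftrightarrow> (\<lambda>i\<in>{..<n}. s i x) \<in> X"
      unfolding X by (simp only: mem_Collect_eq restrict_in_cpow simp_thms)
  qed
  finally show ?thesis .
qed

lemma definable_Collect:
  assumes "dpred M P"
  shows "definable M n {x \<in> cpow n. P x}"
proof -
  obtain p s where s: "\<And>i. slot (s i)" and P: "P = (\<lambda>x. sat M (\<lambda>i. s i x) p)"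
    using assms unfolding dpred_def by blast
  \<comment> \<open>On \<open>cpow n\<close> every slot is a coordinate below \<open>n\<close> or a
    constant, because a coordinate from \<open>n\<close> on has the value \<open>undefined\<close>
    there. A variable \<open>i\<close> with constant value gets its own index \<open>n + i\<close>,
    so distinct parameters do not collide.\<close>
  have "\<exists>k c. (\<forall>x\<in>cpow n. s i x = (if k < n then x k else c)) \<and> (k < n \<or> k = n + i)" for i
  proof -
    consider j where "j < n" "s i = (\<lambda>x. x j)" | j where "\<not> j < n" "s i = (\<lambda>x. x j)" | c where "s i = (\<lambda>x. c)"
      using s[of i] unfolding slot_def by auto
    then show ?thesis
    proof cases
      case 1
      then show ?thesis by (intro exI[of _ j]) simp
    next
      case 2
      then show ?thesis
        by (intro exI[of _ "n + i"] exI[of _ undefined]) (auto simp: cpow_def PiE_def extensional_def)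
    next
      case 3
      then show ?thesis by (intro exI[of _ "n + i"] exI[of _ c]) auto
    qed
  qed
  then obtain \<rho> c where
    \<rho>: "\<And>i x. x \<in> cpow n \<Longrightarrow> s i x = (if \<rho> i < n then x (\<rho> i) else c i)" "\<And>i. \<rho> i < n \<or> \<rho> i = n + i"
    by metis
  obtain q where q: "\<And>e. sat M e q = sat M (\<lambda>i. e (\<rho> i)) p"
    using sat_rename[of M \<rho> p] by blast
  have "P x = sat M (\<lambda>i. if i < n then x i else c (i - n)) q" if "x \<in> cpow n" for x
    unfolding P q by (rule sat_cong) (use \<rho>(1)[OF that] \<rho>(2) in \<open>metis add_diff_cancel_left'\<close>)
  then have "{x \<in> cpow n. P x} = {x \<in> cpow n. sat M (\<lambda>i. if i < n then x i else c (i - n)) q}"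
    by auto
  then show ?thesis
    unfolding definable_def by (intro exI[of _ q] exI[of _ "\<lambda>i. c (i - n)"])
qed

text \<open>The tuple version of the convention for one quantifier: the premise reads the bound
  tuple from the first \<open>n\<close> coordinates and the environment from those shifted by
  \<open>n\<close>.\<close>

lemma dpred_ex_tuple:
  assumes "dpred M (\<lambda>x. Q (\<lambda>i. x (i + n)) (\<lambda>i\<in>{..<n}. x i))"
  shows "dpred M (\<lambda>x. \<exists>y\<in>cpow n. Q x y)"
  using assms
proof (induction n arbitrary: Q)
  case 0
  then show ?case by (simp add: cpow_def)
next
  case (Suc n)
  let ?cons = "\<lambda>a y. \<lambda>i\<in>{..<Suc n}. case i of 0 \<Rightarrow> a | Suc k \<Rightarrow> y k"
  \<comment> \<open>The head of the tuple is quantified outermost, so under the quantifiers for the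
    tail it sits at coordinate \<open>n\<close>, while the premise expects it at \<open>0\<close>.
    The rotation \<open>?s\<close> of the first \<open>Suc n\<close> coordinates reconciles the
    two.\<close>
  let ?s = "\<lambda>i. if i = 0 then n else if i < Suc n then i - 1 else i"
  have "dpred M (\<lambda>x. Q (\<lambda>i. x (?s (i + Suc n))) (\<lambda>i\<in>{..<Suc n}. x (?s i)))"
    using dpred_subst[OF Suc.prems, of "\<lambda>i x. x (?s i)"] by (simp only: slot_var)
  moreover have "(\<lambda>i\<in>{..<Suc n}. x (?s i)) = ?cons (x n) (\<lambda>i\<in>{..<n}. x i)" for x :: "nat \<Rightarrow> 'c"
    by (rule ext) (auto split: nat.split)
  ultimately have "dpred M (\<lambda>x. Q (\<lambda>i. x (Suc i + n)) (?cons (x n) (\<lambda>i\<in>{..<n}. x i)))"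
    by simp
  then have "dpred M (\<lambda>x. Q (\<lambda>i. x (Suc i + n)) (?cons (x (0 + n)) (\<lambda>i\<in>{..<n}. x i)))"
    by (unfold add_0)
  from dpred_ex[OF Suc.IH[of "\<lambda>x y. Q (\<lambda>i. x (Suc i)) (?cons (x 0) y)", OF this]]
  have "dpred M (\<lambda>x. \<exists>a. \<exists>y\<in>cpow n. Q x (?cons a y))" .
  moreover have "(\<exists>y\<in>cpow (Suc n). Q x y) \<longleftrightarrow> (\<exists>a. \<exists>y\<in>cpow n. Q x (?cons a y))" for x
  proof
    assume "\<exists>y\<in>cpow (Suc n). Q x y"
    then obtain y where y: "y \<in> cpow (Suc n)" "Q x y" by blast
    have "?cons (y 0) (\<lambda>i\<in>{..<n}. y (Suc i)) = y"
      by (rule cpow_eqI[OF restrict_in_cpow y(1)]) (simp split: nat.split)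
    then show "\<exists>a. \<exists>y\<in>cpow n. Q x (?cons a y)" using y(2) restrict_in_cpow by metis
  next
    assume "\<exists>a. \<exists>y\<in>cpow n. Q x (?cons a y)"
    then show "\<exists>y\<in>cpow (Suc n). Q x y" using restrict_in_cpow by blast
  qed
  ultimately show ?case by simp
qed

section \<open>The order topology on Cartesian powers\<close>

text \<open>The condition that all coordinates differ by less than \<open>r\<close>, written without
  subtraction or absolute value, since terms have only addition and multiplication. This makes it an
  atomic matter for definability.\<close>

definition near :: "nat \<Rightarrow> (nat \<Rightarrow> 'a::linordered_field) \<Rightarrow> 'a \<Rightarrow> (nat \<Rightarrow> 'a) \<Rightarrow> bool" where
  "near n p r z \<longleftrightarrow> (\<forall>i<n. p i < z i + r \<and> z i < p i + r)"

lemma near_refl: "0 < r \<Longrightarrow> near n p r p"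
  by (simp add: near_def)

lemma near_sym: "near n p r z \<longleftrightarrow> near n z r p"
  by (auto simp: near_def)

lemma near_mono: "near n p r z \<Longrightarrow> r \<le> s \<Longrightarrow> near n p s z"
  unfolding near_def by (meson add_left_mono less_le_trans)

lemma near_trans:
  assumes "near n p r z" "near n z s w" shows "near n p (r + s) w"
  unfolding near_def
proof (intro allI impI)
  fix i assume i: "i < n"
  have "p i < z i + r" "z i < p i + r" "z i < w i + s" "w i < z i + s"
    using assms i by (auto simp: near_def)
  then show "p i < w i + (r + s) \<and> w i < p i + (r + s)"
    by (auto simp: algebra_simps intro: less_trans[of _ "z i + r"] less_trans[of _ "z i + s"])
qed

lemma near_limit_unique:
  assumes "p \<in> cpow n" "q \<in> cpow n" and "\<And>r. 0 < r \<Longrightarrow> near n p r q"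
  shows "p = q"
proof (rule cpow_eqI[OF assms(1,2)])
  fix i assume i: "i < n"
  have "p i \<le> q i + r \<and> q i \<le> p i + r" if "0 < r" for r
    using assms(3)[OF that] i by (auto simp: near_def intro: less_imp_le)
  then show "p i = q i" by (meson field_le_epsilon order_antisym)
qed

lemma open_contains_interval:
  fixes S :: "'a::{linordered_field, linorder_topology} set"
  assumes "open S" "a \<in> S"
  shows "\<exists>r>0. \<forall>x. a < x + r \<and> x < a + r \<longrightarrow> x \<in> S"
proof -
  obtain b where b: "b > a" "{a..<b} \<subseteq> S"
    using open_right[OF assms, of "a + 1"] by auto
  obtain c where c: "c < a" "{c<..a} \<subseteq> S"
    using open_left[OF assms, of "a - 1"] by auto
  show ?thesis
  proof (intro exI[of _ "min (b - a) (a - c)"] conjI allI impI)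
    show "0 < min (b - a) (a - c)" using b c by simp
    fix x assume "a < x + min (b - a) (a - c) \<and> x < a + min (b - a) (a - c)"
    then have "c < x" "x < b" by (auto simp: min_def split: if_splits)
    then show "x \<in> S" using b c by (cases "x \<le> a") auto
  qed
qed

lemma closure_approx:
  fixes S :: "'a::{linordered_field, linorder_topology} set"
  shows "a \<in> closure S \<longleftrightarrow> (\<forall>r>0. \<exists>x\<in>S. a < x + r \<and> x < a + r)"
proof
  assume a: "a \<in> closure S"
  show "\<forall>r>0. \<exists>x\<in>S. a < x + r \<and> x < a + r"
  proof (intro allI impI)
    fix r :: 'a assume "0 < r"
    then have "a \<in> {a - r<..<a + r} \<inter> closure S" using a by simp
    then have "{a - r<..<a + r} \<inter> S \<noteq> {}"
      using open_Int_closure_eq_empty[OF open_greaterThanLessThan[of "a - r" "a + r"], of S] by blast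
    then show "\<exists>x\<in>S. a < x + r \<and> x < a + r" by (force simp: algebra_simps)
  qed
next
  assume *: "\<forall>r>0. \<exists>x\<in>S. a < x + r \<and> x < a + r"
  show "a \<in> closure S"
  proof (rule ccontr)
    assume "a \<notin> closure S"
    then obtain r where "r > 0" "\<forall>x. a < x + r \<and> x < a + r \<longrightarrow> x \<in> - closure S"
      using open_contains_interval[of "- closure S" a] by auto
    with * show False using closure_subset by fastforce
  qed
qed

section \<open>Closedness, continuity and limit sets in terms of radii\<close>

lemma topspace_cpow_top: "topspace (cpow_top n) = cpow n"
  by (simp add: cpow_top_def cpow_def)

lemma openin_near:
  "openin (cpow_top n) {z \<in> cpow n. near n p r z}"
proof -
  have "openin (cpow_top n) (\<Pi>\<^sub>E i\<in>{..<n}. {p i - r<..<p i + r})"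
    unfolding cpow_top_def by (simp add: openin_PiE_gen)
  also have "(\<Pi>\<^sub>E i\<in>{..<n}. {p i - r<..<p i + r}) = {z \<in> cpow n. near n p r z}"
    by (auto simp: cpow_def near_def PiE_def Pi_def algebra_simps)
  finally show ?thesis .
qed

lemma near_subset_open:
  fixes p :: "nat \<Rightarrow> 'a::{linordered_field, linorder_topology}"
  assumes "openin (cpow_top n) U" "p \<in> U"
  shows "\<exists>r>0. \<forall>z\<in>cpow n. near n p r z \<longrightarrow> z \<in> U"
proof -
  have "\<exists>V. (\<forall>i\<in>{..<n}. open (V i)) \<and> p \<in> (\<Pi>\<^sub>E i\<in>{..<n}. V i) \<and> (\<Pi>\<^sub>E i\<in>{..<n}. V i) \<subseteq> U"
    using assms by (simp add: cpow_top_def openin_product_topology_alt)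
  then obtain V where V: "\<And>i. i < n \<Longrightarrow> open (V i)" "p \<in> (\<Pi>\<^sub>E i\<in>{..<n}. V i)" "(\<Pi>\<^sub>E i\<in>{..<n}. V i) \<subseteq> U"
    by (metis lessThan_iff)
  have "\<exists>r>0. \<forall>x. p i < x + r \<and> x < p i + r \<longrightarrow> x \<in> V i" if "i < n" for i
    using open_contains_interval[OF V(1)[OF that]] V(2) that by auto
  then obtain r where r: "\<And>i. i < n \<Longrightarrow> r i > 0"
    "\<And>i x. i < n \<Longrightarrow> p i < x + r i \<and> x < p i + r i \<Longrightarrow> x \<in> V i" by metis
  define s where "s = Min (insert 1 (r ` {..<n}))"
  have s: "s > 0" "\<And>i. i < n \<Longrightarrow> s \<le> r i"
    using r(1) by (auto simp: s_def)
  show ?thesis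
  proof (intro exI[of _ s] conjI ballI impI s(1))
    fix z assume z: "z \<in> cpow n" "near n p s z"
    have "z i \<in> V i" if i: "i < n" for i
    proof -
      have "p i < z i + s \<and> z i < p i + s" using z(2) i by (simp add: near_def)
      then have "p i < z i + r i \<and> z i < p i + r i"
        using s(2)[OF i] by (meson add_left_mono less_le_trans)
      then show ?thesis using r(2)[OF i] by blast
    qed
    then show "z \<in> U" using V(3) z(1) by (auto simp: cpow_def PiE_def Pi_def)
  qed
qed

text \<open>Relative closedness becomes the statement that points of \<open>X\<close> approximated
  by \<open>S\<close> belong to \<open>S\<close>; the later arguments use only this form.\<close>

lemma closedin_cpow_iff:
  fixes X :: "(nat \<Rightarrow> 'a::{linordered_field, linorder_topology}) set"
  assumes "X \<subseteq> cpow n" "S \<subseteq> X"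
  shows "closedin (subtopology (cpow_top n) X) S \<longleftrightarrow>
    (\<forall>p\<in>X. (\<forall>r>0. \<exists>z\<in>S. near n p r z) \<longrightarrow> p \<in> S)"
proof
  have ts: "topspace (subtopology (cpow_top n) X) = X"
    using assms by (auto simp: topspace_cpow_top)
  {
    assume "closedin (subtopology (cpow_top n) X) S"
    then obtain U where U: "openin (cpow_top n) U" "X - S = U \<inter> X"
      unfolding closedin_def ts openin_subtopology by auto
    show "\<forall>p\<in>X. (\<forall>r>0. \<exists>z\<in>S. near n p r z) \<longrightarrow> p \<in> S"
    proof (intro ballI impI, rule ccontr)
      fix p assume p: "p \<in> X" "\<forall>r>0. \<exists>z\<in>S. near n p r z" "p \<notin> S"
      then obtain r where r: "r > 0" "\<And>z. z \<in> cpow n \<Longrightarrow> near n p r z \<Longrightarrow> z \<in> U"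
        using near_subset_open[OF U(1), of p] U(2) by blast
      obtain z where "z \<in> S" "near n p r z" using p(2) r(1) by blast
      then show False using r(2)[of z] U(2) assms by blast
    qed
  next
    assume *: "\<forall>p\<in>X. (\<forall>r>0. \<exists>z\<in>S. near n p r z) \<longrightarrow> p \<in> S"
    \<comment> \<open>All radius neighbourhoods missing \<open>S\<close>: their union is open, and
      by the assumption it cuts out exactly \<open>X - S\<close> on \<open>X\<close>.\<close>
    define U where "U = \<Union>{{z \<in> cpow n. near n p r z} | p r. 0 < r \<and> (\<forall>z\<in>S. \<not> near n p r z)}"
    have "openin (cpow_top n) U"
      unfolding U_def by (rule openin_Union) (auto intro: openin_near)
    moreover have "X - S = U \<inter> X"
    proof (intro equalityI subsetI)
      fix p assume p: "p \<in> X - S"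
      then obtain r where "r > 0" "\<forall>z\<in>S. \<not> near n p r z" using * by blast
      then show "p \<in> U \<inter> X" using p assms near_refl[of r n p] unfolding U_def by blast
    next
      fix p assume "p \<in> U \<inter> X"
      then show "p \<in> X - S" unfolding U_def by blast
    qed
    ultimately show "closedin (subtopology (cpow_top n) X) S"
      unfolding closedin_def ts openin_subtopology using assms(2) by auto
  }
qed

lemma continuous_near:
  fixes f :: "(nat \<Rightarrow> 'a::{linordered_field, linorder_topology}) \<Rightarrow> nat \<Rightarrow> 'a"
  assumes f: "continuous_map (subtopology (cpow_top m) X) (subtopology (cpow_top n) Y) f"
    and X: "X \<subseteq> cpow m" and x: "x \<in> X" and r: "0 < r"
  shows "\<exists>\<delta>>0. \<forall>z\<in>X. near m x \<delta> z \<longrightarrow> near n (f x) r (f z)"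
proof -
  have f': "continuous_map (subtopology (cpow_top m) X) (cpow_top n) f"
    using f by (simp add: continuous_map_in_subtopology)
  have ts: "topspace (subtopology (cpow_top m) X) = X"
    using X by (auto simp: topspace_cpow_top)
  have fX: "f z \<in> cpow n" if "z \<in> X" for z
    using continuous_map_image_subset_topspace[OF f'] that unfolding ts topspace_cpow_top by blast
  have "openin (subtopology (cpow_top m) X) {z \<in> X. f z \<in> {w \<in> cpow n. near n (f x) r w}}"
    using openin_continuous_map_preimage[OF f' openin_near] unfolding ts .
  then obtain U where U: "openin (cpow_top m) U"
    "{z \<in> X. f z \<in> {w \<in> cpow n. near n (f x) r w}} = U \<inter> X"
    unfolding openin_subtopology by blast
  have "x \<in> U" using U(2) x fX[OF x] near_refl[OF r] by blast
  from near_subset_open[OF U(1) this] obtain \<delta> where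
    "\<delta> > 0" "\<And>z. z \<in> cpow m \<Longrightarrow> near m x \<delta> z \<Longrightarrow> z \<in> U" by blast
  then show ?thesis using U(2) X by blast
qed

lemma continuous_near1:
  fixes g :: "'a::{linordered_field, linorder_topology} \<Rightarrow> nat \<Rightarrow> 'a"
  assumes g: "continuous_map (top_of_set D) (cpow_top n) g" and s: "s \<in> D" and r: "0 < r"
  shows "\<exists>\<delta>>0. \<forall>t\<in>D. s < t + \<delta> \<and> t < s + \<delta> \<longrightarrow> near n (g s) r (g t)"
proof -
  have gD: "g t \<in> cpow n" if "t \<in> D" for t
    using continuous_map_image_subset_topspace[OF g] that unfolding topspace_cpow_top by auto
  have "openin (top_of_set D) {t \<in> D. g t \<in> {w \<in> cpow n. near n (g s) r w}}"
    using openin_continuous_map_preimage[OF g openin_near] by simp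
  then obtain U where U: "open U" "{t \<in> D. g t \<in> {w \<in> cpow n. near n (g s) r w}} = D \<inter> U"
    unfolding openin_open by blast
  have "s \<in> U" using U(2) s gD[OF s] near_refl[OF r] by blast
  from open_contains_interval[OF U(1) this] obtain \<delta> where
    "\<delta> > 0" "\<And>t. s < t + \<delta> \<and> t < s + \<delta> \<Longrightarrow> t \<in> U" by blast
  then show ?thesis using U(2) by blast
qed

lemma open_interval_open:
  fixes I :: "'a::{linordered_field, linorder_topology} set"
  assumes "open_interval I"
  shows "open I"
proof -
  obtain a b where I: "I = {x. a < Fin x \<and> Fin x < b}"
    using assms unfolding open_interval_def by blast
  have "open {x. a < Fin x}"
    by (cases a) (auto intro: open_greaterThan[unfolded greaterThan_def])
  moreover have "open {x. Fin x < b}"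
    by (cases b) (auto intro: open_lessThan[unfolded lessThan_def])
  ultimately show ?thesis unfolding I by (rule open_Collect_conj)
qed

lemma open_interval_around: "open_interval {x. a < x + r \<and> x < a + r}"
  for a :: "'a::linordered_field"
  unfolding open_interval_def
  by (rule exI[of _ "Fin (a - r)"], rule exI[of _ "Fin (a + r)"]) (simp add: algebra_simps)

lemma open_box_near: "open_box n {z \<in> cpow n. near n p r z}"
  unfolding open_box_def
  by (rule exI[of _ "\<lambda>i. {x. p i < x + r \<and> x < p i + r}"])
    (auto simp: open_interval_around cpow_def near_def PiE_def Pi_def)

lemma open_box_open:
  fixes B :: "(nat \<Rightarrow> 'a::{linordered_field, linorder_topology}) set"
  assumes "open_box n B"
  shows "openin (cpow_top n) B"
proof -
  obtain J where J: "\<forall>i<n. open_interval (J i)" "B = (\<Pi>\<^sub>E i\<in>{..<n}. J i)"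
    using assms unfolding open_box_def by blast
  show ?thesis
    using J(1) unfolding J(2) cpow_top_def by (simp add: openin_PiE_gen open_interval_open)
qed

text \<open>Radius neighbourhoods are themselves boxes and every box around \<open>p\<close>
  contains one. As \<open>D\<close> consists of positive elements, an interval around
  \<open>0\<close> can be replaced by the bound \<open>t < \<delta>\<close>.\<close>

lemma Lim_set_near:
  fixes g :: "'a::{linordered_field, linorder_topology} \<Rightarrow> nat \<Rightarrow> 'a"
  assumes D: "D \<subseteq> {0<..}" and g: "g ` D \<subseteq> cpow n"
  shows "p \<in> Lim_set n D g \<longleftrightarrow> p \<in> cpow n \<and> (\<forall>r>0. \<forall>\<delta>>0. \<exists>t\<in>D. t < \<delta> \<and> near n p r (g t))"
proof (intro iffI conjI allI impI)
  assume p: "p \<in> Lim_set n D g"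
  then show pn: "p \<in> cpow n" by (simp add: Lim_set_def)
  fix r \<delta> :: 'a assume r: "0 < r" and \<delta>: "0 < \<delta>"
  have "p \<in> {z \<in> cpow n. near n p r z}" "0 \<in> {x. 0 < x + \<delta> \<and> x < 0 + \<delta>}"
    using pn near_refl[OF r] \<delta> by auto
  then have "{t \<in> D. g t \<in> {z \<in> cpow n. near n p r z}} \<inter> {x. 0 < x + \<delta> \<and> x < 0 + \<delta>} \<noteq> {}"
    using p open_box_near[of n p r] open_interval_around[of 0 \<delta>]
    unfolding Lim_set_def by blast
  then show "\<exists>t\<in>D. t < \<delta> \<and> near n p r (g t)" by auto
next
  assume *: "p \<in> cpow n \<and> (\<forall>r>0. \<forall>\<delta>>0. \<exists>t\<in>D. t < \<delta> \<and> near n p r (g t))"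
  show "p \<in> Lim_set n D g"
    unfolding Lim_set_def
  proof (intro CollectI conjI allI impI)
    show "p \<in> cpow n" using * by simp
    fix B I assume BI: "open_box n B \<and> p \<in> B \<and> open_interval I \<and> (0::'a) \<in> I"
    then obtain r where r: "r > 0" "\<And>z. z \<in> cpow n \<Longrightarrow> near n p r z \<Longrightarrow> z \<in> B"
      using near_subset_open[OF open_box_open, of n B p] by blast
    obtain \<delta> :: 'a where \<delta>: "\<delta> > 0" "\<And>x. 0 < x + \<delta> \<and> x < 0 + \<delta> \<Longrightarrow> x \<in> I"
      using open_contains_interval[OF open_interval_open, of I 0] BI by blast
    obtain t where t: "t \<in> D" "t < \<delta>" "near n p r (g t)" using * r(1) \<delta>(1) by blast
    have "0 < t" using D t(1) by auto
    then have "t \<in> I" using \<delta> t(2) by (intro \<delta>(2)) (auto intro: add_pos_pos)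
    then show "{t \<in> D. g t \<in> B} \<inter> I \<noteq> {}" using t r(2)[of "g t"] g by blast
  qed
qed

section \<open>Definable maps and pseudo-curves\<close>

lemma point1_0: "point1 a 0 = a"
  by (simp add: point1_def)

lemma point1_in_cpow: "point1 a \<in> cpow 1"
  unfolding point1_def by (rule restrict_in_cpow)

lemma cpow_1E: "x \<in> cpow 1 \<Longrightarrow> x = point1 (x 0)"
  by (rule cpow_eqI[OF _ point1_in_cpow]) (simp_all only: less_one point1_0)

lemma restrict_eq_point1: "restrict w {..<1} = point1 (w 0)"
  by (rule ext) (simp add: point1_def)

lemma point1_image_iff: "point1 a \<in> point1 ` D \<longleftrightarrow> a \<in> D"
  by (metis image_iff point1_0)

lemma definable1_Collect:
  assumes "dpred M (\<lambda>x. P (x 0))" shows "definable1 M {a. P a}"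
proof -
  have "point1 ` {a. P a} = {x \<in> cpow 1. P (x 0)}"
  proof (intro equalityI subsetI)
    fix x assume "x \<in> {x \<in> cpow 1. P (x 0)}"
    then have "x = point1 (x 0)" "P (x 0)" using cpow_1E[of x] by blast+
    then show "x \<in> point1 ` {a. P a}" by blast
  next
    fix x assume "x \<in> point1 ` {a. P a}"
    then show "x \<in> {x \<in> cpow 1. P (x 0)}"
      by (elim imageE) (simp only: mem_Collect_eq point1_in_cpow point1_0 simp_thms)
  qed
  with definable_Collect[OF assms, of 1] show ?thesis unfolding definable1_def by simp
qed

lemma dpred_mem1:
  assumes "definable1 M D" "slot u" shows "dpred M (\<lambda>x. u x \<in> D)"
  using dpred_mem[OF assms(1)[unfolded definable1_def], of "\<lambda>_. u"] assms(2)
  by (simp only: point1_def[symmetric] point1_image_iff)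

lemma definable_cpow: "definable M n (cpow n)"
  using definable_Collect[OF dpred_True, of M n] by simp

lemma dpred_near:
  assumes "slot u" "\<And>i. slot (v i)"
  shows "dpred M (\<lambda>x. near n q (u x) (\<lambda>i. v i x))"
  unfolding near_def by (intro dpred_all_less dpred_conj dpred_less_add assms slot_const)

lemma near_restrict: "near n q r (\<lambda>i\<in>{..<n}. z i) \<longleftrightarrow> near n q r z"
  by (simp add: near_def)

lemma append_point_eq_iff:
  assumes "x \<in> cpow m"
  shows "w \<in> cpow (m + n) \<and> w = append_point m n x y \<longleftrightarrow>
    w \<in> cpow (m + n) \<and> (\<lambda>i\<in>{..<m}. w i) = x \<and> (\<forall>i<n. w (m + i) = y i)"
proof (intro iffI conjI allI impI; elim conjE)
  assume "w = append_point m n x y"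
  then show "(\<lambda>i\<in>{..<m}. w i) = x"
    by (intro cpow_eqI[OF restrict_in_cpow assms]) (simp add: append_point_def)
next
  assume w: "w \<in> cpow (m + n)" and x: "(\<lambda>i\<in>{..<m}. w i) = x" and y: "\<forall>i<n. w (m + i) = y i"
  show "w = append_point m n x y"
  proof (rule cpow_eqI[OF w])
    show "append_point m n x y \<in> cpow (m + n)"
      unfolding append_point_def by (rule restrict_in_cpow)
    fix i assume "i < m + n"
    then show "w i = append_point m n x y i"
      using y[rule_format, of "i - m"] by (auto simp: append_point_def simp flip: x)
  qed
qed (auto simp: append_point_def)

lemma graph_iff:
  assumes "X \<subseteq> cpow m"
  shows "w \<in> (\<lambda>x. append_point m n x (f x)) ` X \<longleftrightarrow>
    w \<in> cpow (m + n) \<and> (\<lambda>i\<in>{..<m}. w i) \<in> X \<and> (\<forall>i<n. w (m + i) = f (\<lambda>i\<in>{..<m}. w i) i)"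
proof -
  have "append_point m n x (f x) \<in> cpow (m + n)" for x
    unfolding append_point_def by (rule restrict_in_cpow)
  then have "w \<in> (\<lambda>x. append_point m n x (f x)) ` X \<longleftrightarrow>
      (\<exists>x\<in>X. w \<in> cpow (m + n) \<and> w = append_point m n x (f x))" by auto
  also have "\<dots> \<longleftrightarrow> (\<exists>x\<in>X. w \<in> cpow (m + n) \<and> (\<lambda>i\<in>{..<m}. w i) = x \<and> (\<forall>i<n. w (m + i) = f x i))"
    by (intro bex_cong refl append_point_eq_iff) (use assms in blast)
  finally show ?thesis by auto
qed

text \<open>Membership in the domain is part of the predicate because the graph says nothing about
  the values of \<open>f\<close> outside \<open>X\<close>.\<close>

lemma dpred_map:
  assumes f: "definable_map M m n X Y f" and u: "\<And>i. slot (u i)" and v: "\<And>i. slot (v i)"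
  shows "dpred M (\<lambda>x. (\<lambda>i\<in>{..<m}. u i x) \<in> X \<and> (\<forall>i<n. v i x = f (\<lambda>i\<in>{..<m}. u i x) i))"
proof -
  have X: "X \<subseteq> cpow m" and G: "definable M (m + n) ((\<lambda>x. append_point m n x (f x)) ` X)"
    using f definable_subset_cpow unfolding definable_map_def by auto
  define s where "s i = (if i < m then u i else v (i - m))" for i
  have "dpred M (\<lambda>x. (\<lambda>i\<in>{..<m + n}. s i x) \<in> (\<lambda>x. append_point m n x (f x)) ` X)"
    by (rule dpred_mem[OF G]) (simp add: s_def u v)
  moreover have "(\<lambda>i\<in>{..<m}. (\<lambda>i\<in>{..<m + n}. s i x) i) = (\<lambda>i\<in>{..<m}. u i x)" for x
    by (rule ext) (simp add: s_def)
  moreover have "(\<forall>i<n. (\<lambda>i\<in>{..<m + n}. s i x) (m + i) = y i) \<longleftrightarrow> (\<forall>i<n. v i x = y i)" for x y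
    by (simp add: s_def)
  ultimately show ?thesis
    unfolding graph_iff[OF X] by (simp only: restrict_in_cpow simp_thms)
qed

lemma dpred_map1:
  assumes g: "definable_map1 M n D Y g" and u: "slot u" and v: "\<And>i. slot (v i)"
  shows "dpred M (\<lambda>x. u x \<in> D \<and> (\<forall>i<n. v i x = g (u x) i))"
  using dpred_map[OF g[unfolded definable_map1_def], of "\<lambda>_. u" v] u v
  by (simp only: point1_def[symmetric] point1_image_iff point1_0)

lemma definable_map1I:
  assumes "definable1 M D" "definable M n Y" "g ` D \<subseteq> Y"
    and G: "dpred M (\<lambda>w. w 0 \<in> D \<and> (\<forall>i<n. w (Suc i) = g (w 0) i))"
  shows "definable_map1 M n D Y g"
proof -
  have D: "point1 ` D \<subseteq> cpow 1" by (rule image_subsetI, rule point1_in_cpow)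
  have "(\<lambda>x. append_point 1 n x (g (x 0))) ` point1 ` D =
      {w \<in> cpow (1 + n). w 0 \<in> D \<and> (\<forall>i<n. w (Suc i) = g (w 0) i)}"
    by (intro set_eqI, subst graph_iff[OF D])
      (simp only: restrict_eq_point1 point1_image_iff point1_0 mem_Collect_eq plus_1_eq_Suc)
  then show ?thesis
    using assms(1-3) definable_Collect[OF G, of "1 + n"]
    unfolding definable_map1_def definable_map_def definable1_def
    by (simp add: image_subset_iff point1_0 Pi_iff)
qed

lemma definable_map1D:
  assumes "definable_map1 M n D Y g"
  shows "definable1 M D" "definable M n Y" "g ` D \<subseteq> Y" "Y \<subseteq> cpow n"
  using assms definable_subset_cpow[of M n Y]
  unfolding definable_map1_def definable_map_def definable1_def
  by (simp_all add: image_subset_iff point1_0 Pi_iff)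

lemma definable_map1_codomain:
  assumes "definable_map1 M n D Y g" "definable M n Z" "g ` D \<subseteq> Z"
  shows "definable_map1 M n D Z g"
  using assms unfolding definable_map1_def definable_map_def
  by (simp add: image_subset_iff point1_0 Pi_iff)

lemma definable_map1_restrict:
  assumes g: "definable_map1 M n D Y g" and D': "definable1 M D'" "D' \<subseteq> D"
  shows "definable_map1 M n D' Y g"
proof (rule definable_map1I[OF D'(1)])
  have "dpred M (\<lambda>w. w 0 \<in> D' \<and> (w 0 \<in> D \<and> (\<forall>i<n. w (Suc i) = g (w 0) i)))"
    by (intro dpred_conj dpred_mem1[OF D'(1)] dpred_map1[OF g] slot_var)
  moreover have "(\<lambda>w. w 0 \<in> D' \<and> (w 0 \<in> D \<and> (\<forall>i<n. w (Suc i) = g (w 0) i))) =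
      (\<lambda>w. w 0 \<in> D' \<and> (\<forall>i<n. w (Suc i) = g (w 0) i))"
    using D'(2) by blast
  ultimately show "dpred M (\<lambda>w. w 0 \<in> D' \<and> (\<forall>i<n. w (Suc i) = g (w 0) i))" by simp
qed (use definable_map1D[OF g] D' in auto)

lemma definable_map1_const:
  assumes "definable1 M D" "definable M n Y" "c \<in> Y"
  shows "definable_map1 M n D Y (\<lambda>_. c)"
  by (rule definable_map1I)
    (use assms in \<open>auto intro!: dpred_conj dpred_mem1 dpred_all_less dpred_eq slot_var slot_const\<close>)

lemma definable_image1:
  assumes g: "definable_map1 M n D Y g"
  shows "definable M n (g ` D)"
proof -
  have "dpred M (\<lambda>z. \<exists>t. t \<in> D \<and> (\<forall>i<n. z i = g t i))"
    by (rule dpred_ex) (intro dpred_map1[OF g] slot_var)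
  from definable_Collect[OF this]
  have "definable M n {z \<in> cpow n. \<exists>t. t \<in> D \<and> (\<forall>i<n. z i = g t i)}" .
  also have "{z \<in> cpow n. \<exists>t. t \<in> D \<and> (\<forall>i<n. z i = g t i)} = g ` D"
  proof (intro equalityI subsetI)
    fix z assume "z \<in> {z \<in> cpow n. \<exists>t. t \<in> D \<and> (\<forall>i<n. z i = g t i)}"
    then obtain t where t: "z \<in> cpow n" "t \<in> D" "\<forall>i<n. z i = g t i" by blast
    then have "z = g t" using definable_map1D(3,4)[OF g] by (intro cpow_eqI[of z n]) auto
    then show "z \<in> g ` D" using t(2) by blast
  qed (use definable_map1D(3,4)[OF g] in auto)
  finally show ?thesis .
qed

text \<open>A value \<open>f x\<close> is not a term of the language, so its membership in
  \<open>K\<close> is expressed by a quantified tuple \<open>y\<close> that lies in \<open>K\<close>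
  and forms with \<open>x\<close> a point of the graph.\<close>

lemma definable_preimage:
  assumes f: "definable_map M m n X Y f" and K: "definable M n K"
  shows "definable M m {x \<in> X. f x \<in> K}"
proof -
  have X: "X \<subseteq> cpow m" and fX: "\<And>x. x \<in> X \<Longrightarrow> f x \<in> cpow n"
    using f definable_subset_cpow[of M m X] definable_subset_cpow[of M n Y]
    unfolding definable_map_def by auto
  have "dpred M (\<lambda>x. ((\<lambda>i\<in>{..<m}. x (i + n)) \<in> X \<and>
      (\<forall>i<n. x i = f (\<lambda>i\<in>{..<m}. x (i + n)) i)) \<and> (\<lambda>i\<in>{..<n}. x i) \<in> K)"
    by (intro dpred_conj dpred_map[OF f] dpred_mem[OF K] slot_var)
  then have "dpred M (\<lambda>x. ((\<lambda>i\<in>{..<m}. x (i + n)) \<in> X \<and>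
      (\<forall>i<n. (\<lambda>i\<in>{..<n}. x i) i = f (\<lambda>i\<in>{..<m}. x (i + n)) i)) \<and> (\<lambda>i\<in>{..<n}. x i) \<in> K)"
    by simp
  from definable_Collect[OF dpred_ex_tuple[of M "\<lambda>x y. ((\<lambda>i\<in>{..<m}. x i) \<in> X \<and>
      (\<forall>i<n. y i = f (\<lambda>i\<in>{..<m}. x i) i)) \<and> y \<in> K" n, OF this]]
  have "definable M m {x \<in> cpow m. \<exists>y\<in>cpow n. ((\<lambda>i\<in>{..<m}. x i) \<in> X \<and>
      (\<forall>i<n. y i = f (\<lambda>i\<in>{..<m}. x i) i)) \<and> y \<in> K}" .
  also have "\<dots> = {x \<in> X. f x \<in> K}"
  proof (intro equalityI subsetI)
    fix x assume "x \<in> {x \<in> cpow m. \<exists>y\<in>cpow n. ((\<lambda>i\<in>{..<m}. x i) \<in> X \<and>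
      (\<forall>i<n. y i = f (\<lambda>i\<in>{..<m}. x i) i)) \<and> y \<in> K}"
    then obtain y where y: "x \<in> X" "y \<in> cpow n" "\<forall>i<n. y i = f x i" "y \<in> K"
      by (auto simp: restrict_cpow)
    have "y = f x" by (rule cpow_eqI[OF y(2) fX[OF y(1)]]) (use y in simp)
    then show "x \<in> {x \<in> X. f x \<in> K}" using y by simp
  next
    fix x assume "x \<in> {x \<in> X. f x \<in> K}"
    then show "x \<in> {x \<in> cpow m. \<exists>y\<in>cpow n. ((\<lambda>i\<in>{..<m}. x i) \<in> X \<and>
      (\<forall>i<n. y i = f (\<lambda>i\<in>{..<m}. x i) i)) \<and> y \<in> K}"
      using X fX by (auto simp: restrict_cpow subset_iff)
  qed
  finally show ?thesis .
qed

section \<open>Pseudo-filters, convergent curves and curve selection\<close>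

lemma good_pseudo_filterD:
  assumes "good_pseudo_filter M \<DD>" "D \<in> \<DD>"
  shows "definable1 M D" "D \<subseteq> {0<..}" "0 \<in> closure D" "bdd_above D" "closure D = D \<union> {0}"
proof -
  have "\<forall>D\<in>\<DD>. definable1 M D \<and> D \<subseteq> {0<..} \<and> 0 \<in> closure D"
    using assms(1) unfolding good_pseudo_filter_def by (elim conjE)
  moreover have "\<forall>D\<in>\<DD>. bdd_below D \<and> bdd_above D \<and> closure D = D \<union> {0}"
    using assms(1) unfolding good_pseudo_filter_def by (elim conjE)
  ultimately show "definable1 M D" "D \<subseteq> {0<..}" "0 \<in> closure D" "bdd_above D" "closure D = D \<union> {0}"
    using assms(2) by simp_all
qed

lemma good_pseudo_filter_nonempty: "good_pseudo_filter M \<DD> \<Longrightarrow> \<DD> \<noteq> {}"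
  unfolding good_pseudo_filter_def by (elim conjE)

lemma good_pseudo_filter_continuous:
  assumes "good_pseudo_filter M \<DD>" "D \<in> \<DD>" "definable_map1 M n D (cpow n) g"
  obtains D' where "D' \<in> \<DD>" "D' \<subseteq> D" "continuous_map (top_of_set D') (cpow_top n) g"
proof -
  have "\<forall>D\<in>\<DD>. \<forall>n g. definable_map1 M n D (cpow n) g \<longrightarrow>
      (\<exists>D'\<in>\<DD>. D' \<subseteq> D \<and> continuous_map (top_of_set D') (cpow_top n) g) \<and>
      (Lim_set n D g \<noteq> {} \<longrightarrow>
        (\<exists>D'\<in>\<DD>. D' \<subseteq> D \<and> continuous_map (top_of_set D') (cpow_top n) g \<and>
           is_singleton (Lim_set n D' g)))"
    using assms(1) unfolding good_pseudo_filter_def by (elim conjE)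
  from this[rule_format, OF assms(2,3), THEN conjunct1] show thesis by (elim bexE conjE) (rule that)
qed

lemma pseudo_filter_small:
  assumes "good_pseudo_filter M \<DD>" "D \<in> \<DD>" "0 < \<delta>"
  shows "\<exists>t\<in>D. t < \<delta>"
  using good_pseudo_filterD(3)[OF assms(1,2)] assms(3) closure_approx[of 0 D] by auto

text \<open>The parameter itself bounds the distance to \<open>p\<close>. A limit point
  \<open>q\<close> is within \<open>r / 2\<close> of some \<open>g t\<close> with
  \<open>t < r / 2\<close>, hence within \<open>r\<close> of \<open>p\<close>; small parameters show
  that \<open>p\<close> is a limit point.\<close>

lemma curve_Lim_eq:
  fixes M :: "('f, 'r, 'a::{linordered_field, linorder_topology}) expansion"
  assumes filter: "good_pseudo_filter M \<DD>" and D: "D \<in> \<DD>" and p: "p \<in> cpow n"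
    and g: "g ` D \<subseteq> cpow n" and close: "\<And>t. t \<in> D \<Longrightarrow> near n p t (g t)"
  shows "Lim_set n D g = {p}"
proof (intro equalityI subsetI)
  note Lim_iff = Lim_set_near[OF good_pseudo_filterD(2)[OF filter D] g]
  fix q assume "q \<in> Lim_set n D g"
  then have q: "q \<in> cpow n" "\<And>r \<delta>. 0 < r \<Longrightarrow> 0 < \<delta> \<Longrightarrow> \<exists>t\<in>D. t < \<delta> \<and> near n q r (g t)"
    by (auto simp: Lim_iff)
  have "q = p"
  proof (rule near_limit_unique[OF q(1) p])
    fix r :: 'a assume r: "0 < r"
    then obtain t where t: "t \<in> D" "t < r / 2" "near n q (r / 2) (g t)"
      using q(2)[of "r / 2" "r / 2"] by auto
    have "near n (g t) (r / 2) p"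
      using near_mono[OF close[OF t(1)], of "r / 2"] t(2) near_sym by auto
    from near_trans[OF t(3) this] show "near n q r p" by simp
  qed
  then show "q \<in> {p}" by simp
next
  note Lim_iff = Lim_set_near[OF good_pseudo_filterD(2)[OF filter D] g]
  fix q assume "q \<in> {p}"
  moreover have "\<exists>t\<in>D. t < \<delta> \<and> near n p r (g t)" if "0 < r" "0 < \<delta>" for r \<delta>
  proof -
    obtain t where t: "t \<in> D" "t < min r \<delta>"
      using pseudo_filter_small[OF filter D, of "min r \<delta>"] \<open>0 < r\<close> \<open>0 < \<delta>\<close> by auto
    then show ?thesis using near_mono[OF close[OF t(1)], of r] by auto
  qed
  ultimately show "q \<in> Lim_set n D g" using p by (auto simp: Lim_iff)
qed

lemma constant_curve:
  assumes filter: "good_pseudo_filter M \<DD>" and D: "D \<in> \<DD>"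
    and X: "definable M n X" and x: "x \<in> X"
  shows "pseudo_curve M \<DD> n D X (\<lambda>_. x)" "Lim_set n D (\<lambda>_. x) = {x}"
proof -
  have xn: "x \<in> cpow n" using definable_subset_cpow[OF X] x by blast
  show "pseudo_curve M \<DD> n D X (\<lambda>_. x)"
    unfolding pseudo_curve_def
  proof (intro conjI D)
    show "definable_map1 M n D (cpow n) (\<lambda>_. x)"
      by (rule definable_map1_const[OF good_pseudo_filterD(1)[OF filter D] definable_cpow xn])
    show "continuous_map (top_of_set D) (cpow_top n) (\<lambda>_. x)"
      by (rule continuous_map_const[THEN iffD2]) (simp add: topspace_cpow_top xn)
  qed (use x in auto)
  show "Lim_set n D (\<lambda>_. x) = {x}"
    using good_pseudo_filterD(2)[OF filter D] xn
    by (intro curve_Lim_eq[OF filter D xn] near_refl) auto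
qed

text \<open>The parameter \<open>t\<close> serves as a radius: a definable choice of a point of
  \<open>Z\<close> within \<open>t\<close> of \<open>p\<close> converges to \<open>p\<close> at
  \<open>0\<close>.\<close>

lemma curve_selection:
  fixes M :: "('f, 'r, 'a::{linordered_field, linorder_topology}) expansion"
  assumes choice: "definable_choice M" and filter: "good_pseudo_filter M \<DD>"
    and Z: "definable M n Z" and p: "p \<in> cpow n" and approx: "\<And>r. 0 < r \<Longrightarrow> \<exists>z\<in>Z. near n p r z"
  obtains D g where "pseudo_curve M \<DD> n D Z g" "Lim_set n D g = {p}"
proof -
  obtain D where D: "D \<in> \<DD>" using good_pseudo_filter_nonempty[OF filter] by blast
  note D_def = good_pseudo_filterD(1)[OF filter D]
  have Zn: "Z \<subseteq> cpow n" using definable_subset_cpow[OF Z] .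
  \<comment> \<open>A tuple \<open>w\<close> encodes a pair: coordinate \<open>0\<close> is the
    radius, the remaining \<open>n\<close> coordinates are the point of \<open>Z\<close>.\<close>
  define P where "P w \<longleftrightarrow> w 0 \<in> D \<and> (\<lambda>i\<in>{..<n}. w (Suc i)) \<in> Z \<and> near n p (w 0) (\<lambda>i. w (Suc i))"
    for w :: "nat \<Rightarrow> 'a"
  have "dpred M P"
    unfolding P_def by (intro dpred_conj dpred_mem1[OF D_def] dpred_mem[OF Z] dpred_near slot_var)
  then have W: "definable M (1 + n) {w \<in> cpow (1 + n). P w}" by (rule definable_Collect)
  have proj: "coord_proj 1 id w = point1 (w 0)" for w :: "nat \<Rightarrow> 'a"
    by (rule ext) (simp add: coord_proj_def point1_def)
  have "coord_proj 1 id ` {w \<in> cpow (1 + n). P w} = point1 ` D"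
  proof (intro equalityI subsetI)
    fix x assume "x \<in> point1 ` D"
    then obtain t where t: "x = point1 t" "t \<in> D" by blast
    then have "0 < t" using good_pseudo_filterD(2)[OF filter D] by auto
    then obtain z where z: "z \<in> Z" "near n p t z" using approx by blast
    define w where "w = (\<lambda>i\<in>{..<1 + n}. case i of 0 \<Rightarrow> t | Suc k \<Rightarrow> z k)"
    have w0: "w 0 = t" by (simp add: w_def)
    have wz: "(\<lambda>i\<in>{..<n}. w (Suc i)) = z"
      by (rule cpow_eqI[OF restrict_in_cpow]) (use z Zn in \<open>auto simp: w_def\<close>)
    have "near n p t (\<lambda>i. w (Suc i))"
      using z(2) near_restrict[of n p t "\<lambda>i. w (Suc i)"] by (simp only: wz)
    then have "P w" using t z unfolding P_def w0 wz by blast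
    moreover have "w \<in> cpow (1 + n)" unfolding w_def by (rule restrict_in_cpow)
    ultimately show "x \<in> coord_proj 1 id ` {w \<in> cpow (1 + n). P w}"
      using t(1) w0 by (intro image_eqI[of _ _ w]) (simp_all only: proj mem_Collect_eq simp_thms)
  next
    fix x assume "x \<in> coord_proj 1 id ` {w \<in> cpow (1 + n). P w}"
    then obtain w where "P w" "x = point1 (w 0)" unfolding proj by blast
    then show "x \<in> point1 ` D" unfolding P_def by blast
  qed
  moreover have "strict_mono_on {..<1::nat} id" by (rule strict_mono_onI) auto
  moreover have "id ` {..<1} \<subseteq> {..<1 + n}" by auto
  ultimately obtain h where h: "definable_map M 1 (1 + n) (point1 ` D) {w \<in> cpow (1 + n). P w} h"
    "\<And>x. x \<in> point1 ` D \<Longrightarrow> coord_proj 1 id (h x) = x"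
    using choice[unfolded definable_choice_def, THEN conjunct1] D_def[unfolded definable1_def] W by meson
  \<comment> \<open>The chosen map is a section of the projection, so it returns the radius
    unchanged and its other coordinates are a point within that same radius.\<close>
  have h0: "h (point1 t) 0 = t" if "t \<in> D" for t
    using h(2)[of "point1 t"] that by (metis imageI point1_0 proj)
  define g where "g t = (\<lambda>i\<in>{..<n}. h (point1 t) (Suc i))" for t
  have gZ: "g t \<in> Z" and gp: "near n p t (g t)" if "t \<in> D" for t
  proof -
    have "P (h (point1 t))" using h(1) that unfolding definable_map_def by auto
    then show "g t \<in> Z" "near n p t (g t)"
      using h0[OF that] unfolding P_def g_def near_restrict by auto
  qed
  have gn: "g t \<in> cpow n" for t unfolding g_def by (rule restrict_in_cpow)
  have g: "definable_map1 M n D (cpow n) g"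
  proof (rule definable_map1I[OF D_def definable_cpow])
    show "g ` D \<subseteq> cpow n" using gn by blast
    \<comment> \<open>The graph of \<open>g\<close> coincides with that of \<open>h\<close>, because
      \<open>h\<close> returns \<open>t\<close> together with \<open>g t\<close>; the extra equation
      at index \<open>0\<close> is \<open>h0\<close>.\<close>
    have "dpred M (\<lambda>w. (\<lambda>i\<in>{..<1}. w 0) \<in> point1 ` D \<and> (\<forall>i<1 + n. w i = h (\<lambda>i\<in>{..<1}. w 0) i))"
      by (intro dpred_map[OF h(1)] slot_var)
    moreover have "(\<lambda>i\<in>{..<1}. w 0) \<in> point1 ` D \<and> (\<forall>i<1 + n. w i = h (\<lambda>i\<in>{..<1}. w 0) i) \<longleftrightarrow>
        w 0 \<in> D \<and> (\<forall>i<n. w (Suc i) = g (w 0) i)" for w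
      unfolding point1_def[symmetric] point1_image_iff
      by (auto simp: g_def less_Suc_eq_0_disj h0)
    ultimately show "dpred M (\<lambda>w. w 0 \<in> D \<and> (\<forall>i<n. w (Suc i) = g (w 0) i))" by (simp only:)
  qed
  \<comment> \<open>Choice gives no continuity; the pseudo-filter supplies it on a smaller
    \<open>D'\<close>, where the distance estimate still holds.\<close>
  obtain D' where D': "D' \<in> \<DD>" "D' \<subseteq> D" "continuous_map (top_of_set D') (cpow_top n) g"
    by (rule good_pseudo_filter_continuous[OF filter D g])
  show thesis
  proof
    show "pseudo_curve M \<DD> n D' Z g"
      unfolding pseudo_curve_def
      using D' gZ definable_map1_restrict[OF g good_pseudo_filterD(1)[OF filter D'(1)] D'(2)] by blast
    show "Lim_set n D' g = {p}"
      by (rule curve_Lim_eq[OF filter D'(1) p]) (use D'(2) gn gp in auto)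
  qed
qed

lemma definable_sup:
  fixes M :: "('f, 'r, 'a::linordered_field) expansion"
  assumes M: "definably_complete M" and A: "definable1 M A" "a \<in> A" "\<And>x. x \<in> A \<Longrightarrow> x \<le> b"
  obtains s where "\<And>x. x \<in> A \<Longrightarrow> x \<le> s" "\<And>c. (\<And>x. x \<in> A \<Longrightarrow> x \<le> c) \<Longrightarrow> s \<le> c"
proof -
  obtain s' where s': "isLub UNIV (Fin ` A) s'"
    using M A(1) unfolding definably_complete_def by blast
  \<comment> \<open>The supremum exists only in the extended line; the element \<open>a\<close> and
    the bound \<open>b\<close> force it to be finite.\<close>
  have "Fin a \<le> s'" using isLubD2[OF s'] A(2) by blast
  moreover have le: "s' \<le> Fin c" if "\<And>x. x \<in> A \<Longrightarrow> x \<le> c" for c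
    by (rule isLub_le_isUb[OF s']) (use that in \<open>auto intro: isUb_UNIV_I\<close>)
  moreover have "s' \<le> Fin b" using le A(3) .
  ultimately obtain s where s: "s' = Fin s" by (cases s') auto
  show thesis
  proof
    show "x \<le> s" if "x \<in> A" for x using isLubD2[OF s', of "Fin x"] that s by simp
    show "s \<le> c" if "\<And>x. x \<in> A \<Longrightarrow> x \<le> c" for c using le[of c] that s by simp
  qed
qed

text \<open>The parameters at which the curve is close to \<open>q\<close> accumulate at the supremum of their eventual
  lower bounds.\<close>

lemma curve_closure:
  fixes M :: "('f, 'r, 'a::{linordered_field, linorder_topology}) expansion"
  assumes M: "definably_complete M" and filter: "good_pseudo_filter M \<DD>"
    and curve: "pseudo_curve M \<DD> n E Y \<beta>" and q: "q \<in> cpow n"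
    and approx: "\<And>r. 0 < r \<Longrightarrow> \<exists>t\<in>E. near n q r (\<beta> t)"
  shows "q \<in> \<beta> ` E \<union> Lim_set n E \<beta>"
proof -
  have E: "E \<in> \<DD>" and \<beta>: "definable_map1 M n E (cpow n) \<beta>"
    and cont: "continuous_map (top_of_set E) (cpow_top n) \<beta>"
    using curve unfolding pseudo_curve_def by auto
  note E_props = good_pseudo_filterD[OF filter E]
  note \<beta>n = definable_map1D(3)[OF \<beta>]
  \<comment> \<open>The quantified \<open>z\<close> stands for the value of the curve, so that
    \<open>C\<close> is visibly definable; the next fact removes it again.\<close>
  define C where "C r v \<longleftrightarrow> (\<exists>z\<in>cpow n. (v \<in> E \<and> (\<forall>i<n. z i = \<beta> v i)) \<and> near n q r z)" for r v
  have C: "C r v \<longleftrightarrow> v \<in> E \<and> near n q r (\<beta> v)" for r v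
  proof
    assume "C r v"
    then obtain z where "v \<in> E" "\<forall>i<n. z i = \<beta> v i" "near n q r z" unfolding C_def by blast
    then show "v \<in> E \<and> near n q r (\<beta> v)" by (simp add: near_def)
  next
    assume "v \<in> E \<and> near n q r (\<beta> v)"
    then show "C r v" using \<beta>n unfolding C_def by blast
  qed
  \<comment> \<open>\<open>A\<close> collects the \<open>u\<close> below which no parameter brings
    the curve within some fixed radius of \<open>q\<close>.\<close>
  define A where "A = {u. \<exists>r. 0 < r \<and> (\<forall>v. C r v \<longrightarrow> \<not> v < u)}"
  have C_dpred: "dpred M (\<lambda>x. C (x i) (x j))" for i j
    unfolding C_def
  proof (rule dpred_ex_tuple)
    have "dpred M (\<lambda>x. (x (j + n) \<in> E \<and> (\<forall>k<n. x k = \<beta> (x (j + n)) k)) \<and>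
        near n q (x (i + n)) (\<lambda>k. x k))"
      by (intro dpred_conj dpred_map1[OF \<beta>] dpred_near slot_var)
    then show "dpred M (\<lambda>x. (x (j + n) \<in> E \<and> (\<forall>k<n. (\<lambda>k\<in>{..<n}. x k) k = \<beta> (x (j + n)) k)) \<and>
        near n q (x (i + n)) (\<lambda>k\<in>{..<n}. x k))"
      by (simp add: near_restrict)
  qed
  have A: "definable1 M A"
    unfolding A_def
    by (intro definable1_Collect dpred_ex dpred_conj dpred_all dpred_imp C_dpred dpred_not dpred_less
        slot_var slot_const)
  obtain b where b: "\<And>t. t \<in> E \<Longrightarrow> t \<le> b" using E_props(4) unfolding bdd_above_def by blast
  \<comment> \<open>Parameters are positive, so \<open>0\<close> qualifies with radius
    \<open>1\<close>. Conversely every radius admits some parameter, so no element of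
    \<open>A\<close> exceeds the bound \<open>b\<close> of \<open>E\<close>.\<close>
  have "0 \<in> A"
    unfolding A_def C using E_props(2) by (auto intro!: exI[of _ 1])
  moreover have "u \<le> b" if "u \<in> A" for u
    using that approx b unfolding A_def C by (fastforce intro: order_trans)
  ultimately obtain s where s_ub: "\<And>u. u \<in> A \<Longrightarrow> u \<le> s"
    and s_least: "\<And>c. (\<And>u. u \<in> A \<Longrightarrow> u \<le> c) \<Longrightarrow> s \<le> c"
    using definable_sup[OF M A] by blast
  \<comment> \<open>Otherwise an element \<open>u > s - \<eta>\<close> of \<open>A\<close> with its
    radius \<open>r'\<close> shows that every parameter good for \<open>min r r'\<close> is at least
    \<open>s + \<eta>\<close>. Then \<open>s + \<eta>\<close> lies in \<open>A\<close>, beyond its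
    upper bound \<open>s\<close>.\<close>
  have acc: "\<exists>v\<in>E. near n q r (\<beta> v) \<and> s < v + \<eta> \<and> v < s + \<eta>" if r: "0 < r" and \<eta>: "0 < \<eta>" for r \<eta>
  proof (rule ccontr)
    assume no: "\<not> ?thesis"
    have "\<not> s \<le> s - \<eta>" using \<eta> by simp
    then obtain u where u: "u \<in> A" "s - \<eta> < u" using s_least[of "s - \<eta>"] by force
    obtain r' where r': "0 < r'" "\<And>v. v \<in> E \<Longrightarrow> near n q r' (\<beta> v) \<Longrightarrow> u \<le> v"
      using u(1) unfolding A_def C by (auto simp: not_less)
    have "s + \<eta> \<in> A"
      unfolding A_def C
    proof (intro CollectI exI[of _ "min r r'"] conjI allI impI)
      show "0 < min r r'" using r r' by simp
      fix v assume v: "v \<in> E \<and> near n q (min r r') (\<beta> v)"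
      then have "near n q r (\<beta> v)" "near n q r' (\<beta> v)"
        using near_mono[of n q "min r r'" "\<beta> v"] by auto
      then show "\<not> v < s + \<eta>"
        using no v r'(2)[of v] u(2) by (auto simp: algebra_simps dest: less_le_trans)
    qed
    then show False using s_ub \<eta> by fastforce
  qed
  \<comment> \<open>Since the closure of \<open>E\<close> adds only \<open>0\<close>, either
    continuity at \<open>s\<close> gives \<open>q = \<beta> s\<close>, or the good parameters tend
    to \<open>0\<close> and \<open>q\<close> is a limit point.\<close>
  have "s \<in> closure E" unfolding closure_approx using acc[of 1] by fastforce
  then consider "s \<in> E" | "s = 0" using E_props(5) by auto
  then show ?thesis
  proof cases
    case 1
    have "\<beta> s \<in> cpow n" using \<beta>n 1 by blast
    then have "q = \<beta> s"
    proof (rule near_limit_unique[OF q])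
      fix r :: 'a assume r: "0 < r"
      then obtain \<delta> where \<delta>: "\<delta> > 0"
        "\<And>t. t \<in> E \<Longrightarrow> s < t + \<delta> \<and> t < s + \<delta> \<Longrightarrow> near n (\<beta> s) (r / 2) (\<beta> t)"
        using continuous_near1[OF cont 1, of "r / 2"] by auto
      obtain v where v: "v \<in> E" "near n q (r / 2) (\<beta> v)" "s < v + \<delta> \<and> v < s + \<delta>"
        using acc[of "r / 2" \<delta>] r \<delta>(1) by auto
      then have "near n (\<beta> v) (r / 2) (\<beta> s)" using \<delta>(2)[of v] near_sym by blast
      from near_trans[OF v(2) this] show "near n q r (\<beta> s)" by simp
    qed
    then show ?thesis using 1 by blast
  next
    case 2
    have "\<exists>t\<in>E. t < \<delta> \<and> near n q r (\<beta> t)" if "0 < r" "0 < \<delta>" for r \<delta>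
      using acc[OF that] unfolding 2 by auto
    then have "q \<in> Lim_set n E \<beta>"
      using q by (simp add: Lim_set_near[OF E_props(2) \<beta>n])
    then show ?thesis by blast
  qed
qed

section \<open>Lifting pseudo-curves along identifying maps\<close>

lemma identifying_lift:
  fixes M :: "('f, 'r, 'a::{linordered_field, linorder_topology}) expansion"
  assumes M: "definably_complete M" and choice: "definable_choice M"
    and filter: "good_pseudo_filter M \<DD>"
    and X: "definable M m X" and Y: "definable M n Y" and f: "definable_map M m n X Y f"
    and cont: "continuous_map (subtopology (cpow_top m) X) (subtopology (cpow_top n) Y) f"
    and ident: "definably_identifying M m n X Y f"
    and curve: "pseudo_curve M \<DD> n E Y \<beta>" and Lim: "Lim_set n E \<beta> = {y}" and y: "y \<in> Y"
  obtains D \<alpha> x where "pseudo_curve M \<DD> m D X \<alpha>" "x \<in> X" "(f \<circ> \<alpha>) ` D \<subseteq> \<beta> ` E"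
    "Lim_set m D \<alpha> = {x}" "f x = y"
proof (cases "y \<in> \<beta> ` E")
  \<comment> \<open>When \<open>y\<close> is itself a value of the curve, a constant curve at a
    preimage of \<open>y\<close> is a lift.\<close>
  case True
  obtain D where D: "D \<in> \<DD>" using good_pseudo_filter_nonempty[OF filter] by blast
  obtain x where x: "x \<in> X" "f x = y"
    using ident y unfolding definably_identifying_def by blast
  show thesis
    by (rule that[OF constant_curve(1)[OF filter D X x(1)] x(1) _ constant_curve(2)[OF filter D X x(1)] x(2)])
      (use True x in auto)
next
  case False
  define K where "K = \<beta> ` E"
  have E: "E \<in> \<DD>" and \<beta>: "definable_map1 M n E (cpow n) \<beta>" and KY: "K \<subseteq> Y"
    using curve unfolding pseudo_curve_def K_def by auto
  have Xm: "X \<subseteq> cpow m" and Yn: "Y \<subseteq> cpow n"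
    using definable_subset_cpow X Y by auto
  have K: "definable M n K" unfolding K_def by (rule definable_image1[OF \<beta>])
  have "\<exists>z\<in>K. near n y r z" if "0 < r" for r
    using Lim_set_near[OF good_pseudo_filterD(2)[OF filter E] definable_map1D(3)[OF \<beta>], of y] that zero_less_one
    unfolding Lim K_def by blast
  then have "\<not> closedin (subtopology (cpow_top n) Y) K"
    unfolding closedin_cpow_iff[OF Yn KY] using y False K_def by blast
  then have "\<not> closedin (subtopology (cpow_top m) X) {x \<in> X. f x \<in> K}"
    using ident KY K unfolding definably_identifying_def by blast
  then obtain x where x: "x \<in> X" "f x \<notin> K" "\<And>r. 0 < r \<Longrightarrow> \<exists>z\<in>{x \<in> X. f x \<in> K}. near m x r z"
    unfolding closedin_cpow_iff[OF Xm Collect_restrict] by blast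
  \<comment> \<open>Selecting the curve inside the preimage of \<open>K\<close> ensures that its
    image under \<open>f\<close> lies in that of \<open>\<beta>\<close>.\<close>
  obtain D \<alpha> where \<alpha>: "pseudo_curve M \<DD> m D {x \<in> X. f x \<in> K} \<alpha>" "Lim_set m D \<alpha> = {x}"
    by (rule curve_selection[OF choice filter definable_preimage[OF f K] _ x(3)]) (use x(1) Xm in blast)+
  have fx: "f x \<in> cpow n" using f x(1) Yn unfolding definable_map_def by blast
  \<comment> \<open>Continuity at \<open>x\<close> transports the approximation by the preimage to
    an approximation of \<open>f x\<close> by \<open>K\<close>. As \<open>f x\<close> is not in
    \<open>K\<close>, it must be the limit \<open>y\<close>.\<close>
  have "f x \<in> \<beta> ` E \<union> Lim_set n E \<beta>"
  proof (rule curve_closure[OF M filter curve fx])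
    fix r :: 'a assume "0 < r"
    then obtain \<delta> where \<delta>: "0 < \<delta>" "\<And>z. z \<in> X \<Longrightarrow> near m x \<delta> z \<Longrightarrow> near n (f x) r (f z)"
      using continuous_near[OF cont Xm x(1)] by blast
    obtain z where "z \<in> X" "f z \<in> K" "near m x \<delta> z" using x(3)[OF \<delta>(1)] by blast
    then show "\<exists>t\<in>E. near n (f x) r (\<beta> t)" using \<delta>(2)[of z] unfolding K_def by fastforce
  qed
  then have "f x = y" using x(2) Lim unfolding K_def by blast
  then show thesis
    using \<alpha> x(1) unfolding pseudo_curve_def K_def by (intro that[of D \<alpha> x]) (auto simp: pseudo_curve_def)
qed

text \<open>The lifting hypothesis is condition (iii), where \<open>\<alpha>\<close> may be
  discontinuous and have several limit points. One limit point in \<open>X\<close> over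
  \<open>y\<close> suffices to test closedness.\<close>

lemma lift_identifying:
  fixes M :: "('f, 'r, 'a::{linordered_field, linorder_topology}) expansion"
  assumes choice: "definable_choice M" and filter: "good_pseudo_filter M \<DD>"
    and X: "definable M m X" and Y: "definable M n Y" and f: "definable_map M m n X Y f"
    and cont: "continuous_map (subtopology (cpow_top m) X) (subtopology (cpow_top n) Y) f"
    and lift: "\<And>E \<beta> y. pseudo_curve M \<DD> n E Y \<beta> \<Longrightarrow> Lim_set n E \<beta> = {y} \<Longrightarrow> y \<in> Y \<Longrightarrow>
      \<exists>D\<in>\<DD>. \<exists>\<alpha> x. definable_map1 M m D X \<alpha> \<and> x \<in> Lim_set m D \<alpha> \<inter> X \<and>
        (f \<circ> \<alpha>) ` D \<subseteq> \<beta> ` E \<and> f x = y"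
  shows "definably_identifying M m n X Y f"
  unfolding definably_identifying_def
proof (intro conjI f cont allI impI; (elim conjE)?)
  have Xm: "X \<subseteq> cpow m" and Yn: "Y \<subseteq> cpow n"
    using definable_subset_cpow X Y by auto
  show "f ` X = Y"
  proof
    show "f ` X \<subseteq> Y" using f unfolding definable_map_def by blast
    obtain D where D: "D \<in> \<DD>" using good_pseudo_filter_nonempty[OF filter] by blast
    show "Y \<subseteq> f ` X"
    proof
      fix y assume y: "y \<in> Y"
      show "y \<in> f ` X"
        using lift[OF constant_curve[OF filter D Y y] y] by blast
    qed
  qed
  fix K assume KY: "K \<subseteq> Y" and K: "definable M n K"
    and closed: "closedin (subtopology (cpow_top m) X) {x \<in> X. f x \<in> K}"
  show "closedin (subtopology (cpow_top n) Y) K"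
    unfolding closedin_cpow_iff[OF Yn KY]
  proof (intro ballI impI)
    fix y assume y: "y \<in> Y" and approx: "\<forall>r>0. \<exists>z\<in>K. near n y r z"
    obtain E \<beta> where \<beta>: "pseudo_curve M \<DD> n E K \<beta>" "Lim_set n E \<beta> = {y}"
      by (rule curve_selection[OF choice filter K, of y]) (use y Yn approx in blast)+
    have "pseudo_curve M \<DD> n E Y \<beta>" using \<beta>(1) KY unfolding pseudo_curve_def by blast
    from lift[OF this \<beta>(2) y] obtain D \<alpha> x where D: "D \<in> \<DD>"
      and \<alpha>: "definable_map1 M m D X \<alpha>" and x: "x \<in> Lim_set m D \<alpha>" "x \<in> X"
      and im: "(f \<circ> \<alpha>) ` D \<subseteq> \<beta> ` E" and fx: "f x = y" by blast
    have \<alpha>X: "\<alpha> t \<in> X" if "t \<in> D" for t using definable_map1D(3)[OF \<alpha>] that by blast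
    then have \<alpha>m: "\<alpha> ` D \<subseteq> cpow m" using Xm by blast
    \<comment> \<open>The lift maps into values of \<open>\<beta>\<close>, which lie in
      \<open>K\<close>, so it runs inside the closed preimage and approximates \<open>x\<close>
      there.\<close>
    have "\<exists>z\<in>{x \<in> X. f x \<in> K}. near m x r z" if r: "0 < r" for r
    proof -
      obtain t where t: "t \<in> D" "near m x r (\<alpha> t)"
        using x(1) r zero_less_one unfolding Lim_set_near[OF good_pseudo_filterD(2)[OF filter D] \<alpha>m] by blast
      have "f (\<alpha> t) \<in> \<beta> ` E" using im t(1) by auto
      moreover have "\<beta> ` E \<subseteq> K" using \<beta>(1) unfolding pseudo_curve_def by blast
      ultimately show ?thesis using \<alpha>X t by blast
    qed
    then have "x \<in> {x \<in> X. f x \<in> K}"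
      using closed x(2) unfolding closedin_cpow_iff[OF Xm Collect_restrict] by blast
    then show "y \<in> K" using fx by blast
  qed
qed

theorem lemma3p13:
  fixes M :: "('f, 'r, 'a::{linordered_field, linorder_topology}) expansion"
    and \<DD> :: "'a set set"
    and m n :: nat
    and X Y :: "(nat \<Rightarrow> 'a) set"
    and f :: "(nat \<Rightarrow> 'a) \<Rightarrow> nat \<Rightarrow> 'a"
  assumes "definably_complete M"
    and "definable_choice M"
    and "good_pseudo_filter M \<DD>"
    and "definable M m X"
    and "definable M n Y"
    and "definable_map M m n X Y f"
    and "continuous_map (subtopology (cpow_top m) X) (subtopology (cpow_top n) Y) f"
  shows "(definably_identifying M m n X Y f \<longleftrightarrow>
      (\<forall>E \<beta>. pseudo_curve M \<DD> n E Y \<beta> \<and> is_singleton (Lim_set n E \<beta>) \<and> Lim_set n E \<beta> \<subseteq> Y \<longrightarrow>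
        (\<exists>D \<alpha> x. pseudo_curve M \<DD> m D X \<alpha> \<and> x \<in> X \<and> (f \<circ> \<alpha>) ` D \<subseteq> \<beta> ` E \<and>
           Lim_set m D \<alpha> = {x} \<and> f x \<in> Lim_set n E \<beta>))) \<and>
    (definably_identifying M m n X Y f \<longleftrightarrow>
      (\<forall>E \<beta>. pseudo_curve M \<DD> n E Y \<beta> \<and> is_singleton (Lim_set n E \<beta>) \<and> Lim_set n E \<beta> \<subseteq> Y \<longrightarrow>
        (\<exists>D\<in>\<DD>. \<exists>\<alpha> x. definable_map1 M m D X \<alpha> \<and> x \<in> Lim_set m D \<alpha> \<inter> X \<and>
           (f \<circ> \<alpha>) ` D \<subseteq> \<beta> ` E \<and> f x \<in> Lim_set n E \<beta>)))"
    (is "(?i \<longleftrightarrow> ?ii) \<and> (?i \<longleftrightarrow> ?iii)")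
proof -
  \<comment> \<open>The equivalences follow from the cycle (i), (ii), (iii), (i).\<close>
  have "?i \<Longrightarrow> ?ii"
  proof (intro allI impI, elim conjE)
    fix E \<beta>
    assume ident: ?i and curve: "pseudo_curve M \<DD> n E Y \<beta>"
      and "is_singleton (Lim_set n E \<beta>)" and sub: "Lim_set n E \<beta> \<subseteq> Y"
    then obtain y where y: "Lim_set n E \<beta> = {y}" by (auto simp: is_singleton_def)
    then have "y \<in> Y" using sub by simp
    from identifying_lift[OF assms ident curve y this]
    show "\<exists>D \<alpha> x. pseudo_curve M \<DD> m D X \<alpha> \<and> x \<in> X \<and> (f \<circ> \<alpha>) ` D \<subseteq> \<beta> ` E \<and>
        Lim_set m D \<alpha> = {x} \<and> f x \<in> Lim_set n E \<beta>"
      unfolding y by (metis singletonI)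
  qed
  moreover have "?ii \<Longrightarrow> ?iii"
  proof (intro allI impI)
    fix E \<beta>
    assume ?ii and "pseudo_curve M \<DD> n E Y \<beta> \<and> is_singleton (Lim_set n E \<beta>) \<and> Lim_set n E \<beta> \<subseteq> Y"
    then obtain D \<alpha> x where \<alpha>: "pseudo_curve M \<DD> m D X \<alpha>" "x \<in> X" "(f \<circ> \<alpha>) ` D \<subseteq> \<beta> ` E"
      "Lim_set m D \<alpha> = {x}" "f x \<in> Lim_set n E \<beta>" by blast
    \<comment> \<open>A pseudo-curve is recorded as a definable map into \<open>cpow m\<close> with
      image in \<open>X\<close>; condition (iii) wants \<open>X\<close> as codomain.\<close>
    have D: "D \<in> \<DD>" "definable_map1 M m D (cpow m) \<alpha>" "\<alpha> ` D \<subseteq> X"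
      using \<alpha>(1) unfolding pseudo_curve_def by auto
    show "\<exists>D\<in>\<DD>. \<exists>\<alpha> x. definable_map1 M m D X \<alpha> \<and> x \<in> Lim_set m D \<alpha> \<inter> X \<and>
        (f \<circ> \<alpha>) ` D \<subseteq> \<beta> ` E \<and> f x \<in> Lim_set n E \<beta>"
      using D(1) definable_map1_codomain[OF D(2) assms(4) D(3)] \<alpha> by blast
  qed
  moreover have "?iii \<Longrightarrow> ?i"
  proof (rule lift_identifying[OF assms(2-7)])
    fix E \<beta> y
    assume iii: ?iii and curve: "pseudo_curve M \<DD> n E Y \<beta>" and y: "Lim_set n E \<beta> = {y}" "y \<in> Y"
    have "is_singleton (Lim_set n E \<beta>)" "Lim_set n E \<beta> \<subseteq> Y" using y by auto
    with iii curve show "\<exists>D\<in>\<DD>. \<exists>\<alpha> x. definable_map1 M m D X \<alpha> \<and> x \<in> Lim_set m D \<alpha> \<inter> X \<and>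
        (f \<circ> \<alpha>) ` D \<subseteq> \<beta> ` E \<and> f x = y"
      using y(1) by (metis singletonD)
  qed
  ultimately show ?thesis by argo
qed

end
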